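(* Suppose that $(A_{\text{true}},B_{\text{true}})\in\Sigma_{\text{stab}}$, the data $\mathcal{D}$ are $\Sigma_{\text{stab}}$-informative for stabilization, and $\operatorname{rank}X_-<n$. Let $r=\operatorname{rank}X_-$, let $S\in\mathbb{R}^{n\times n}$ be nonsingular and $\hat X_-\in\mathbb{R}^{r\times T}$ be of full row rank such that $SX_-=\begin{bmatrix}\hat X_-\\0\end{bmatrix}$, and let $\hat X_+=\begin{bmatrix}I_r&0\end{bmatrix}SX_+\in\mathbb{R}^{r\times T}$. Then the following statements hold: (a) There exists $\Theta\in\mathbb{R}^{T\times r}$ such that $$\hat X_-\Theta=\Theta^\top\hat X_-^\top\quad\text{and}\quad\begin{bmatrix}\hat X_-\Theta&\hat X_+\Theta\\ \Theta^\top\hat X_+^\top&\hat X_-\Theta\end{bmatrix}>0.\qquad(\ast)$$ (b) Suppose that $\Theta\in\mathbb{R}^{T\times r}$ satisfies $(\ast)$. Let $K=\begin{bmatrix}K_1&K_2\end{bmatrix}S$, where $K_1=U_-\Theta(\hat X_-\Theta)^{-1}$ and $K_2\in\mathbb{R}^{m\times(n-r)}$ is arbitrary. Then $A+BK$ is Schur for all $(A,B)\in\Sigma_{\mathcal{D}}\cap\Sigma_{\text{stab}}$.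
   Context: Let $n,m,T$ be positive integers and $\mathcal{M}=\mathbb{R}^{n\times n}\times\mathbb{R}^{n\times m}$. Let $(A_{\text{true}},B_{\text{true}})\in\mathcal{M}$ be the (unknown) true system. The data $\mathcal{D}$ consist of inputs $u(0),\dots,u(T-1)\in\mathbb{R}^m$ and states $x(0),\dots,x(T)\in\mathbb{R}^n$ satisfying $x(t+1)=A_{\text{true}}x(t)+B_{\text{true}}u(t)$ for $t=0,\dots,T-1$. Set $U_-=\begin{bmatrix}u(0)&\cdots&u(T-1)\end{bmatrix}$, $X_-=\begin{bmatrix}x(0)&\cdots&x(T-1)\end{bmatrix}$, $X_+=\begin{bmatrix}x(1)&\cdots&x(T)\end{bmatrix}$. The set of data-consistent systems is $\Sigma_{\mathcal{D}}=\{(A,B)\in\mathcal{M}\mid X_+=AX_-+BU_-\}$. A real square matrix is Schur if all its eigenvalues have modulus strictly less than $1$. The set $\Sigma_{\text{stab}}$ is the set of all stabilizable pairs $(A,B)\in\mathcal{M}$, i.e. those for which there is $K\in\mathbb{R}^{m\times n}$ with $A+BK$ Schur. The data $\mathcal{D}$ are called $\Sigma_{\text{stab}}$-informative for stabilization if there exists a single $K\in\mathbb{R}^{m\times n}$ such that $A+BK$ is Schur for all $(A,B)\in\Sigma_{\mathcal{D}}\cap\Sigma_{\text{stab}}$. For a real square matrix $M$, $M>0$ means that $M$ is symmetric with all eigenvalues positive. *)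

theory Defs
  imports
    "Jordan_Normal_Form.DL_Rank"
    "Jordan_Normal_Form.Char_Poly"
    "Jordan_Normal_Form.Gauss_Jordan_Elimination"
begin

definition append_cols :: "'a :: zero mat \<Rightarrow> 'a mat \<Rightarrow> 'a mat" (infixr "@\<^sub>c" 65) where
  "A @\<^sub>c B = four_block_mat A B (0\<^sub>m 0 (dim_col A)) (0\<^sub>m 0 (dim_col B))"

text \<open>The eigenvalues of a real matrix are its complex eigenvalues, hence the embedding
  into complex matrices in the next two definitions.\<close>

definition schur :: "real mat \<Rightarrow> bool" where
  "schur M \<longleftrightarrow> square_mat M \<and>
    (\<forall>k. eigenvalue (map_mat complex_of_real M) k \<longrightarrow> cmod k < 1)"

definition pos_def_mat :: "real mat \<Rightarrow> bool" where
  "pos_def_mat M \<longleftrightarrow> square_mat M \<and> transpose_mat M = M \<and>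
    (\<forall>k. eigenvalue (map_mat complex_of_real M) k \<longrightarrow> Im k = 0 \<and> 0 < Re k)"

definition stabilizable_pairs :: "nat \<Rightarrow> nat \<Rightarrow> (real mat \<times> real mat) set" where
  "stabilizable_pairs n m = {(A, B). A \<in> carrier_mat n n \<and> B \<in> carrier_mat n m \<and>
    (\<exists>K \<in> carrier_mat m n. schur (A + B * K))}"

definition consistent_systems ::
  "nat \<Rightarrow> nat \<Rightarrow> real mat \<Rightarrow> real mat \<Rightarrow> real mat \<Rightarrow> (real mat \<times> real mat) set" where
  "consistent_systems n m Um Xm Xp = {(A, B). A \<in> carrier_mat n n \<and> B \<in> carrier_mat n m \<and>
    Xp = A * Xm + B * Um}"

definition stab_informative :: "nat \<Rightarrow> nat \<Rightarrow> real mat \<Rightarrow> real mat \<Rightarrow> real mat \<Rightarrow> bool" where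
  "stab_informative n m Um Xm Xp \<longleftrightarrow> (\<exists>K \<in> carrier_mat m n.
    \<forall>(A, B) \<in> consistent_systems n m Um Xm Xp \<inter> stabilizable_pairs n m. schur (A + B * K))"

definition lmi_solution :: "real mat \<Rightarrow> real mat \<Rightarrow> real mat \<Rightarrow> bool" where
  "lmi_solution Xm Xp \<Theta> \<longleftrightarrow>
    Xm * \<Theta> = transpose_mat \<Theta> * transpose_mat Xm \<and>
    pos_def_mat (four_block_mat (Xm * \<Theta>) (Xp * \<Theta>)
      (transpose_mat \<Theta> * transpose_mat Xp) (Xm * \<Theta>))"

end

theory Submission
  imports Defs "Jordan_Normal_Form.Spectral_Radius"
begin

text \<open>
  Let K be a gain as provided by informativity, and let c be orthogonal to the columns of Xm. If
  M = A + B K is Schur and c were not orthogonal to (l - M)^(-1) B g for some real l >= 1, then adding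
  a suitable multiple of (B g) c^T to A would give a system that is still consistent, is still
  stabilizable (the change can be cancelled by feedback), and has l as a closed-loop eigenvalue under K.
  Hence all these vectors lie in the column space of Xm, and letting l tend to infinity so does the whole
  reachable subspace of (M, B).

  Since Schur matrices form an open set, a row relation between Xm and Um that involves Um
  would allow a small perturbation of the system violating this, so no such relation exists. Therefore the
  columns of Xm are linearly dependent, and this forces the last state x(T) into their span as well.
  Consequently all consistent systems, written in the coordinates given by S, are block
  triangular with no input in the lower block, and the data determine the upper left closed-loop block.
  For that block the linear matrix inequality is a Lyapunov inequality; the lower
  right block is Schur because the system is stabilizable.
\<close>

section \<open>Rank-one updates, powers and inverses\<close>

text \<open>Informativity says nothing about consistent systems that are not stabilizable, so every
  perturbed system must first be shown stabilizable. The two perturbations do this differently. The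
  first changes \<open>A\<close> only, along \<open>B *\<^sub>v g\<close>, so another gain undoes it
  whatever its size. The second changes \<open>B\<close> as well and has to be small, so that the
  gain \<open>K\<close> itself still works.

  If the columns of \<open>Xm\<close> were independent, its rows would span all row vectors of
  length \<open>T\<close>, and every row of \<open>Um\<close> would be a combination of them: a
  forbidden relation, as \<open>0 < m\<close>. A dependency among the columns is pushed forward
  along the closed loop until the last state with a nonzero coefficient becomes x(T); modulo the
  reachable subspace this expresses x(T) by earlier states.

  The absence of relations also makes the matrix inequality solvable: \<open>Xhm\<close> stacked on
  \<open>Um\<close> has full row rank, so \<open>Xhm * \<Theta>\<close> and
  \<open>Um * \<Theta>\<close> can be prescribed independently, as a Lyapunov matrix
  \<open>P\<close> and as \<open>K1 * P\<close>.\<close>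

definition outer :: "'a :: times vec \<Rightarrow> 'a vec \<Rightarrow> 'a mat" where
  "outer v w = mat (dim_vec v) (dim_vec w) (\<lambda>(i, j). v $ i * w $ j)"

lemma outer_carrier [simp]:
  "v \<in> carrier_vec n \<Longrightarrow> w \<in> carrier_vec k \<Longrightarrow> outer v w \<in> carrier_mat n k"
  by (auto simp: outer_def)

lemma outer_mult_vec:
  fixes v :: "'a :: comm_semiring_0 vec"
  assumes "v \<in> carrier_vec n" "w \<in> carrier_vec k" "y \<in> carrier_vec k"
  shows "outer v w *\<^sub>v y = (w \<bullet> y) \<cdot>\<^sub>v v"
  using assms by (intro eq_vecI) (auto simp: outer_def scalar_prod_def sum_distrib_left ac_simps intro!: sum.cong)

lemma outer_mult_mat:
  fixes v :: "'a :: comm_semiring_0 vec"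
  assumes "v \<in> carrier_vec n" "w \<in> carrier_vec k" "Y \<in> carrier_mat k l"
  shows "outer v w * Y = outer v (Y\<^sup>T *\<^sub>v w)"
  using assms by (intro eq_matI) (auto simp: outer_def scalar_prod_def sum_distrib_left ac_simps intro!: sum.cong)

lemma mat_mult_outer:
  fixes v :: "'a :: comm_semiring_0 vec"
  assumes "v \<in> carrier_vec n" "w \<in> carrier_vec k" "Y \<in> carrier_mat l n"
  shows "Y * outer v w = outer (Y *\<^sub>v v) w"
  using assms by (intro eq_matI) (auto simp: outer_def scalar_prod_def sum_distrib_left sum_distrib_right ac_simps intro!: sum.cong)

lemma outer_add_right:
  fixes v :: "'a :: comm_semiring_0 vec"
  assumes "v \<in> carrier_vec n" "w \<in> carrier_vec k" "w' \<in> carrier_vec k"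
  shows "outer v w + outer v w' = outer v (w + w')"
  using assms by (intro eq_matI) (auto simp: outer_def algebra_simps)

lemma outer_zero_right [simp]:
  fixes v :: "'a :: comm_semiring_0 vec"
  assumes "v \<in> carrier_vec n"
  shows "outer v (0\<^sub>v k) = 0\<^sub>m n k"
  using assms by (intro eq_matI) (auto simp: outer_def)

lemma smult_outer:
  fixes v :: "'a :: comm_semiring_0 vec"
  shows "k \<cdot>\<^sub>m outer v w = outer (k \<cdot>\<^sub>v v) w"
  by (intro eq_matI) (auto simp: outer_def ac_simps)

lemma smult_pow_mat:
  fixes A :: "'a :: comm_ring_1 mat"
  assumes A: "A \<in> carrier_mat n n"
  shows "(c \<cdot>\<^sub>m A) ^\<^sub>m k = c ^ k \<cdot>\<^sub>m A ^\<^sub>m k"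
proof (induction k)
  case 0
  then show ?case using A by (intro eq_matI) auto
next
  case (Suc k)
  have Ak: "A ^\<^sub>m k \<in> carrier_mat n n" using A by simp
  have "(c \<cdot>\<^sub>m A) ^\<^sub>m Suc k = (c ^ k \<cdot>\<^sub>m A ^\<^sub>m k) * (c \<cdot>\<^sub>m A)" by (simp add: Suc)
  also have "\<dots> = c \<cdot>\<^sub>m (c ^ k \<cdot>\<^sub>m (A ^\<^sub>m k * A))"
    using mult_smult_distrib[of "c ^ k \<cdot>\<^sub>m A ^\<^sub>m k" n n A n c] mult_smult_assoc_mat[OF Ak A] A Ak by simp
  also have "\<dots> = c ^ Suc k \<cdot>\<^sub>m A ^\<^sub>m Suc k" by (intro eq_matI) auto
  finally show ?case .
qed

lemma pow_mat_Suc_left: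
  assumes A: "A \<in> carrier_mat n n"
  shows "A ^\<^sub>m Suc k = A * A ^\<^sub>m k"
proof (induction k)
  case 0
  then show ?case using A by simp
next
  case (Suc k)
  have "A ^\<^sub>m Suc (Suc k) = A * A ^\<^sub>m k * A" using Suc by simp
  also have "\<dots> = A * (A ^\<^sub>m k * A)" using A pow_carrier_mat[OF A] by (intro assoc_mult_mat) auto
  finally show ?case by simp
qed

lemma eigenvalue_obtain:
  assumes "A \<in> carrier_mat n n" "eigenvalue A k"
  obtains v where "v \<in> carrier_vec n" "v \<noteq> 0\<^sub>v n" "A *\<^sub>v v = k \<cdot>\<^sub>v v"
  using assms unfolding eigenvalue_def eigenvector_def by auto

lemma eigenvalueI:
  assumes "A \<in> carrier_mat n n" "v \<in> carrier_vec n" "v \<noteq> 0\<^sub>v n" "A *\<^sub>v v = k \<cdot>\<^sub>v v"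
  shows "eigenvalue A k"
  using assms unfolding eigenvalue_def eigenvector_def by auto

lemma pow_mat_eigenvector:
  fixes A :: "'a :: field mat"
  assumes A: "A \<in> carrier_mat n n" and v: "v \<in> carrier_vec n" "A *\<^sub>v v = k \<cdot>\<^sub>v v"
  shows "A ^\<^sub>m N *\<^sub>v v = k ^ N \<cdot>\<^sub>v v"
proof (induction N)
  case 0
  then show ?case using A v by auto
next
  case (Suc N)
  have "A ^\<^sub>m Suc N *\<^sub>v v = A ^\<^sub>m N *\<^sub>v (A *\<^sub>v v)"
    using A v by (simp add: assoc_mult_mat_vec[of _ n n _ n])
  also have "\<dots> = k \<cdot>\<^sub>v (A ^\<^sub>m N *\<^sub>v v)"
    using A v by (simp add: mult_mat_vec[of _ n n])
  finally show ?case by (simp add: Suc smult_smult_assoc)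
qed

lemma mult_mat_zero_vec [simp]:
  fixes A :: "'a :: semiring_0 mat"
  assumes "A \<in> carrier_mat n k"
  shows "A *\<^sub>v 0\<^sub>v k = 0\<^sub>v n"
  using assms by (intro eq_vecI) auto

text \<open>The Gram matrix \<open>X\<^sup>T * X\<close> is nonsingular: over the reals a vector
  \<open>v\<close> in its kernel satisfies
  \<open>(X *\<^sub>v v) \<bullet> (X *\<^sub>v v) = 0\<close>.\<close>

lemma left_inverse_if_inj:
  fixes X :: "real mat"
  assumes X: "X \<in> carrier_mat n k"
    and inj: "\<And>v. v \<in> carrier_vec k \<Longrightarrow> X *\<^sub>v v = 0\<^sub>v n \<Longrightarrow> v = 0\<^sub>v k"
  obtains G where "G \<in> carrier_mat k n" "G * X = 1\<^sub>m k"
proof -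
  have XX: "X\<^sup>T * X \<in> carrier_mat k k" using X by simp
  have "det (X\<^sup>T * X) \<noteq> 0"
  proof
    assume "det (X\<^sup>T * X) = 0"
    then obtain v where v: "v \<in> carrier_vec k" "v \<noteq> 0\<^sub>v k" "X\<^sup>T * X *\<^sub>v v = 0\<^sub>v k"
      using det_0_iff_vec_prod_zero[OF XX] by auto
    have Xv: "X *\<^sub>v v \<in> carrier_vec n" using X v by simp
    have "(X *\<^sub>v v) \<bullet> (X *\<^sub>v v) = (X\<^sup>T *\<^sub>v (X *\<^sub>v v)) \<bullet> v"
      using transpose_vec_mult_scalar[OF X v(1) Xv] by simp
    also have "\<dots> = 0" using v X by (simp add: assoc_mult_mat_vec[of _ k n _ k])
    finally have "X *\<^sub>v v = 0\<^sub>v n" using conjugate_square_eq_0_vec[OF Xv] by simp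
    with inj v show False by auto
  qed
  from det_non_zero_imp_unit[OF XX this, of undefined]
  obtain H where H: "H \<in> carrier_mat k k" "H * (X\<^sup>T * X) = 1\<^sub>m k"
    unfolding Units_def ring_mat_def by auto
  show ?thesis
    by (rule that[of "H * X\<^sup>T"]) (use H X in auto)
qed

lemma right_inverse_if_transpose_inj:
  fixes X :: "real mat"
  assumes X: "X \<in> carrier_mat n k"
    and inj: "\<And>v. v \<in> carrier_vec n \<Longrightarrow> X\<^sup>T *\<^sub>v v = 0\<^sub>v k \<Longrightarrow> v = 0\<^sub>v n"
  obtains G where "G \<in> carrier_mat k n" "X * G = 1\<^sub>m n"
proof -
  obtain G where G: "G \<in> carrier_mat n k" "G * X\<^sup>T = 1\<^sub>m n"
    using left_inverse_if_inj[of "X\<^sup>T" k n] X inj by auto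
  have "(G * X\<^sup>T)\<^sup>T = X * G\<^sup>T"
    using transpose_mult[of G n k "X\<^sup>T" n] G(1) X by simp
  then have "X * G\<^sup>T = 1\<^sub>m n" unfolding G(2) by simp
  then show ?thesis using that[of "G\<^sup>T"] G by simp
qed

text \<open>Justifies the \<open>the\<close> around \<open>mat_inverse\<close> in the formula for
  \<open>K1\<close>: for an injective square matrix the inversion does not return
  \<open>None\<close>.\<close>

lemma mat_inverse_if_inj:
  fixes P :: "real mat"
  assumes P: "P \<in> carrier_mat n n"
    and inj: "\<And>v. v \<in> carrier_vec n \<Longrightarrow> P *\<^sub>v v = 0\<^sub>v n \<Longrightarrow> v = 0\<^sub>v n"
  shows "the (mat_inverse P) \<in> carrier_mat n n" "P * the (mat_inverse P) = 1\<^sub>m n"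
    "the (mat_inverse P) * P = 1\<^sub>m n"
proof -
  have "det P \<noteq> 0" using det_0_iff_vec_prod_zero[OF P] inj by auto
  from det_non_zero_imp_unit[OF P this, of undefined]
  obtain Q where Q: "mat_inverse P = Some Q"
    using mat_inverse(1)[OF P, of undefined] by (cases "mat_inverse P") auto
  from mat_inverse(2)[OF P Q]
  show "the (mat_inverse P) \<in> carrier_mat n n" "P * the (mat_inverse P) = 1\<^sub>m n"
    "the (mat_inverse P) * P = 1\<^sub>m n" using Q by auto
qed

text \<open>A maximal independent set of columns has \<open>r\<close> elements and is thus a basis,
  so \<open>a = X *\<^sub>v y\<close> for some \<open>y\<close>, and
  \<open>a \<bullet> a = (X\<^sup>T *\<^sub>v a) \<bullet> y = 0\<close>.\<close>

lemma full_row_rank_transpose_inj: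
  fixes X :: "real mat"
  assumes X: "X \<in> carrier_mat r k" and rank: "vec_space.rank r X = r"
    and a: "a \<in> carrier_vec r" and ker: "X\<^sup>T *\<^sub>v a = 0\<^sub>v k"
  shows "a = 0\<^sub>v r"
proof -
  interpret vec_space "TYPE(real)" r .
  have fin: "finite (set (cols X))" and sub: "set (cols X) \<subseteq> carrier_vec r"
    using X cols_dim[of X] by auto
  obtain S where S: "maximal S (\<lambda>U. U \<subseteq> set (cols X) \<and> lin_indpt U)"
    using maximal_exists_superset[OF fin, of "\<lambda>U. U \<subseteq> set (cols X) \<and> lin_indpt U" "{}"]
      unfolding lin_dep_def by auto
  have card: "card S = r" using rank_card_indpt[OF X S] rank by simp
  have S': "S \<subseteq> set (cols X)" "lin_indpt S" using S unfolding maximal_def by auto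
  have "basis S"
    using dim_li_is_basis[of S] S' fin sub card dim_is_n finite_subset[OF S'(1) fin] by auto
  then have "span S = carrier_vec r" unfolding basis_def by auto
  then have "a \<in> col_space X"
    using span_is_monotone[OF S'(1)] a unfolding col_space_def by auto
  then obtain y where y: "y \<in> carrier_vec k" "X *\<^sub>v y = a"
    using col_space_eq[OF X] X by auto
  have "a \<bullet> a = (X\<^sup>T *\<^sub>v a) \<bullet> y"
    using transpose_vec_mult_scalar[OF X y(1) a] y by simp
  also have "\<dots> = 0" using ker y by simp
  finally show ?thesis using conjugate_square_eq_0_vec[OF a] by simp
qed

section \<open>Schur matrices\<close>

abbreviation cmat :: "real mat \<Rightarrow> complex mat" where
  "cmat \<equiv> map_mat complex_of_real"

text \<open>Dividing \<open>M\<close> by a number \<open>s < 1\<close> above all eigenvalue moduli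
  leaves a matrix of spectral radius below 1, whose powers are bounded; so the powers of
  \<open>M\<close> decay like \<open>s ^ k\<close>.\<close>

lemma schur_pow_small:
  assumes M: "M \<in> carrier_mat n n" and "schur M" and "0 < e"
  shows "\<exists>N. \<forall>k\<ge>N. \<forall>i<n. \<forall>j<n. \<bar>(M ^\<^sub>m k) $$ (i, j)\<bar> < e"
proof (cases "n = 0")
  case False
  let ?A = "cmat M"
  have A: "?A \<in> carrier_mat n n" using M by simp
  have fin: "finite (spectrum ?A)" using card_finite_spectrum[OF A] by simp
  \<comment> \<open>Midpoint between the largest modulus and 1, hence positive even for a nilpotent
    \<open>M\<close>. The inserted 0 makes the set visibly nonempty and its maximum
    nonnegative.\<close>
  define s where "s = (1 + Max (insert 0 (cmod ` spectrum ?A))) / 2"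
  have max1: "Max (insert 0 (cmod ` spectrum ?A)) < 1"
    using fin \<open>schur M\<close> by (auto simp: schur_def spectrum_def)
  have "0 \<le> Max (insert 0 (cmod ` spectrum ?A))" using fin by (intro Max_ge) auto
  then have s: "0 < s" "s < 1" using max1 by (simp_all add: s_def)
  have ev: "cmod k < s" if "eigenvalue ?A k" for k
  proof -
    have "cmod k \<le> Max (insert 0 (cmod ` spectrum ?A))"
      using fin that by (intro Max_ge) (auto simp: spectrum_def)
    then show ?thesis using max1 by (simp add: s_def)
  qed
  define B where "B = complex_of_real (1 / s) \<cdot>\<^sub>m ?A"
  have B: "B \<in> carrier_mat n n" using A by (simp add: B_def)
  have "cmod k < 1" if ev_k: "eigenvalue B k" for k
  proof -
    obtain v where v: "v \<in> carrier_vec n" "v \<noteq> 0\<^sub>v n" "B *\<^sub>v v = k \<cdot>\<^sub>v v"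
      using eigenvalue_obtain[OF B ev_k] .
    have AB: "?A = complex_of_real s \<cdot>\<^sub>m B"
      using s by (intro eq_matI) (auto simp: B_def)
    have "?A *\<^sub>v v = complex_of_real s \<cdot>\<^sub>v (B *\<^sub>v v)"
      unfolding AB using B v(1) by (intro eq_vecI) auto
    also have "\<dots> = (of_real s * k) \<cdot>\<^sub>v v" by (simp add: v smult_smult_assoc)
    finally have "eigenvalue ?A (of_real s * k)" using eigenvalueI[OF A v(1,2)] by simp
    from ev[OF this] s show ?thesis by (simp add: norm_mult)
  qed
  then have "spectral_radius B < 1"
    using spectral_radius_mem_max(1)[OF B] False by (auto simp: spectrum_def)
  from spectral_radius_jnf_norm_bound_less_1_upper_triangular[OF B this]
  obtain c where c: "\<And>k. norm_bound (B ^\<^sub>m k) c" by blast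
  have entry: "\<bar>(M ^\<^sub>m k) $$ (i, j)\<bar> \<le> s ^ k * c" if "i < n" "j < n" for i j k
  proof -
    have "B ^\<^sub>m k = complex_of_real (1 / s) ^ k \<cdot>\<^sub>m cmat (M ^\<^sub>m k)"
      unfolding B_def smult_pow_mat[OF A] of_real_hom.mat_hom_pow[OF M] ..
    then have "cmod ((B ^\<^sub>m k) $$ (i, j)) = (1 / s) ^ k * \<bar>(M ^\<^sub>m k) $$ (i, j)\<bar>"
      using that M s by (simp add: norm_mult norm_power norm_divide)
    moreover have "cmod ((B ^\<^sub>m k) $$ (i, j)) \<le> c"
      using c[of k] that B by (auto simp: norm_bound_def)
    ultimately have "(1 / s) ^ k * \<bar>(M ^\<^sub>m k) $$ (i, j)\<bar> \<le> c" by simp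
    then show ?thesis using s by (simp add: power_one_over field_simps)
  qed
  have "(\<lambda>k. s ^ k * c) \<longlonglongrightarrow> 0 * c"
    using s by (intro tendsto_mult LIMSEQ_power_zero tendsto_const) auto
  then have "\<forall>\<^sub>F k in sequentially. s ^ k * c < e"
    using order_tendstoD(2)[of "\<lambda>k. s ^ k * c" 0 sequentially e] \<open>0 < e\<close> by simp
  then obtain N where "\<And>k. k \<ge> N \<Longrightarrow> s ^ k * c < e"
    by (auto simp: eventually_sequentially)
  then show ?thesis using entry by (meson le_less_trans)
qed auto

text \<open>One power suffices, which is what permits a perturbation argument. Comparing both sides
  of M^N v = k^N v at a coordinate of largest modulus bounds \<open>cmod k ^ N\<close> by
  \<open>real n * e\<close>.\<close>

lemma schur_if_pow_small:
  assumes M: "M \<in> carrier_mat n n" and e: "real n * e < 1"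
    and small: "\<And>i j. i < n \<Longrightarrow> j < n \<Longrightarrow> \<bar>(M ^\<^sub>m N) $$ (i, j)\<bar> < e"
  shows "schur M"
  unfolding schur_def
proof (intro conjI allI impI)
  show "square_mat M" using M by auto
  fix k assume "eigenvalue (cmat M) k"
  moreover have A: "cmat M \<in> carrier_mat n n" using M by simp
  ultimately obtain v where v: "v \<in> carrier_vec n" "v \<noteq> 0\<^sub>v n" "cmat M *\<^sub>v v = k \<cdot>\<^sub>v v"
    using eigenvalue_obtain by blast
  from v(2) v(1) obtain i where i: "i < n" "v $ i \<noteq> 0" by fastforce
  define mx where "mx = Max ((\<lambda>j. cmod (v $ j)) ` {..<n})"
  have mx: "cmod (v $ j) \<le> mx" if "j < n" for j
    using that by (auto simp: mx_def)
  have "mx > 0" using mx[OF i(1)] i(2) by (smt (verit) norm_le_zero_iff)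
  have "mx \<in> (\<lambda>j. cmod (v $ j)) ` {..<n}"
    unfolding mx_def using i(1) by (intro Max_in) auto
  then obtain l where l: "l < n" "cmod (v $ l) = mx" by auto
  have "k ^ N * v $ l = (cmat M ^\<^sub>m N *\<^sub>v v) $ l"
    using pow_mat_eigenvector[OF A v(1,3)] l v(1) by simp
  also have "\<dots> = (\<Sum>j = 0..<n. complex_of_real ((M ^\<^sub>m N) $$ (l, j)) * v $ j)"
    using l v(1) M A
    by (simp add: of_real_hom.mat_hom_pow[OF M, symmetric] scalar_prod_def)
  finally have "cmod k ^ N * mx = cmod (\<Sum>j = 0..<n. complex_of_real ((M ^\<^sub>m N) $$ (l, j)) * v $ j)"
    using l(2) by (metis norm_mult norm_power)
  also have "\<dots> \<le> (\<Sum>j = 0..<n. e * mx)"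
  proof (intro sum_norm_le)
    fix j assume "j \<in> {0..<n}"
    then show "cmod (complex_of_real ((M ^\<^sub>m N) $$ (l, j)) * v $ j) \<le> e * mx"
      using small[OF l(1), of j] mx[of j] unfolding norm_mult norm_of_real
      by (intro mult_mono) (auto simp del: index_mult_mat intro: order_trans[OF abs_ge_zero])
  qed
  also have "\<dots> < 1 * mx" using e \<open>mx > 0\<close> by simp
  finally have "cmod k ^ N < 1" using \<open>mx > 0\<close> by (simp only: mult_less_cancel_right)
  then show "cmod k < 1" by (meson not_less one_le_power)
qed

text \<open>By the criterion above only one power \<open>N\<close> has to be controlled, and its
  entries are polynomials in \<open>e\<close>, hence continuous at 0. One direction \<open>E\<close>
  is all that the later perturbation asks for.\<close>

lemma schur_open:
  assumes M: "M \<in> carrier_mat n n" and E: "E \<in> carrier_mat n n" and "schur M"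
  shows "\<exists>e>0. schur (M + e \<cdot>\<^sub>m E)"
proof -
  define d where "d = 1 / real (n + 1)"
  have d: "0 < d" "real n * d < 1" by (auto simp: d_def field_simps)
  obtain N where N: "\<forall>i<n. \<forall>j<n. \<bar>(M ^\<^sub>m N) $$ (i, j)\<bar> < d"
    using schur_pow_small[OF M \<open>schur M\<close> d(1)] by blast
  have lim: "((\<lambda>e. ((M + e \<cdot>\<^sub>m E) ^\<^sub>m k) $$ (i, j)) \<longlongrightarrow> (M ^\<^sub>m k) $$ (i, j)) (at_right 0)"
    if "i < n" "j < n" for i j k
    using that
  proof (induction k arbitrary: i j)
    case 0
    then show ?case using M E by simp
  next
    case (Suc k)
    have C: "M + e \<cdot>\<^sub>m E \<in> carrier_mat n n" for e using M E by simp
    have e1: "((M + e \<cdot>\<^sub>m E) ^\<^sub>m Suc k) $$ (i, j) =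
      (\<Sum>l = 0..<n. ((M + e \<cdot>\<^sub>m E) ^\<^sub>m k) $$ (i, l) * (M $$ (l, j) + e * E $$ (l, j)))" for e
      using pow_carrier_mat[OF C, of e k] M E Suc.prems by (auto simp: scalar_prod_def)
    have e2: "(M ^\<^sub>m Suc k) $$ (i, j) =
      (\<Sum>l = 0..<n. (M ^\<^sub>m k) $$ (i, l) * (M $$ (l, j) + 0 * E $$ (l, j)))"
      using pow_carrier_mat[OF M, of k] M Suc.prems by (auto simp: scalar_prod_def)
    show ?case
      unfolding e1 e2 by (intro tendsto_intros Suc) (use Suc.prems in auto)
  qed
  have "\<forall>\<^sub>F e in at_right 0. \<forall>i\<in>{..<n}. \<forall>j\<in>{..<n}. \<bar>((M + e \<cdot>\<^sub>m E) ^\<^sub>m N) $$ (i, j)\<bar> < d"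
    using N by (auto intro!: eventually_ball_finite order_tendstoD(2)[OF tendsto_rabs[OF lim]])
  moreover have "\<forall>\<^sub>F e in at_right (0 :: real). 0 < e" by (simp add: eventually_at_right_less)
  ultimately have "\<forall>\<^sub>F e in at_right 0. 0 < e \<and> schur (M + e \<cdot>\<^sub>m E)"
    by eventually_elim (use M E in \<open>auto intro!: schur_if_pow_small[of _ n d N] d\<close>)
  then show ?thesis using eventually_happens' trivial_limit_at_right_real by blast
qed

text \<open>\<open>F\<close> is the restriction of \<open>M\<close> to the invariant range of
  \<open>G\<close>: having a left inverse, \<open>G\<close> carries eigenvectors of \<open>F\<close>
  to eigenvectors of \<open>M\<close>.\<close>

lemma schur_intertwine:
  assumes M: "M \<in> carrier_mat n n" and F: "F \<in> carrier_mat k k" and G: "G \<in> carrier_mat n k"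
    and H: "H \<in> carrier_mat k n" and HG: "H * G = 1\<^sub>m k" and MG: "M * G = G * F"
    and "schur M"
  shows "schur F"
  unfolding schur_def
proof (intro conjI allI impI)
  show "square_mat F" using F by auto
  fix l assume "eigenvalue (cmat F) l"
  moreover have A: "cmat F \<in> carrier_mat k k" using F by simp
  ultimately obtain v where v: "v \<in> carrier_vec k" "v \<noteq> 0\<^sub>v k" "cmat F *\<^sub>v v = l \<cdot>\<^sub>v v"
    using eigenvalue_obtain by blast
  let ?w = "cmat G *\<^sub>v v"
  have w: "?w \<in> carrier_vec n" using G v by simp
  have "cmat H *\<^sub>v ?w = cmat (H * G) *\<^sub>v v"
    using G H v by (simp add: of_real_hom.mat_hom_mult[OF H G])
  also have "\<dots> = v" using v by (simp add: HG of_real_hom.mat_hom_one)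
  finally have "?w \<noteq> 0\<^sub>v n" using v(2) mult_mat_zero_vec[of "cmat H" k n] H by force
  moreover have "cmat M *\<^sub>v ?w = cmat (M * G) *\<^sub>v v"
    using G M v by (simp add: of_real_hom.mat_hom_mult[OF M G])
  then have "cmat M *\<^sub>v ?w = l \<cdot>\<^sub>v ?w"
    using G F v by (simp add: MG of_real_hom.mat_hom_mult[OF G F] mult_mat_vec[of _ n k])
  ultimately have "eigenvalue (cmat M) l" using eigenvalueI[OF _ w] M by simp
  then show "cmod l < 1" using \<open>schur M\<close> by (simp add: schur_def)
qed

lemma schur_transpose:
  assumes M: "M \<in> carrier_mat n n"
  shows "schur M\<^sup>T \<longleftrightarrow> schur M"
proof -
  have "eigenvalue (cmat M\<^sup>T) k \<longleftrightarrow> eigenvalue (cmat M) k" for k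
    using char_poly_transpose_mat[of "cmat M" n] M
      eigenvalue_root_char_poly[of "cmat M" n] eigenvalue_root_char_poly[of "(cmat M)\<^sup>T" n]
    by (simp add: map_mat_transpose)
  then show ?thesis using M by (auto simp: schur_def)
qed

text \<open>An eigenvector \<open>v\<close> of \<open>M\<close> gives the eigenvector C v of
  \<open>D\<close> unless C v = 0; in that case v = G (H v), and H v is an eigenvector of
  \<open>F\<close>.\<close>

lemma schur_block_triangular:
  assumes M: "M \<in> carrier_mat n n" and F: "F \<in> carrier_mat k k" and D: "D \<in> carrier_mat q q"
    and G: "G \<in> carrier_mat n k" and H: "H \<in> carrier_mat k n"
    and C: "C \<in> carrier_mat q n" and L: "L \<in> carrier_mat n q"
    and HG: "H * G = 1\<^sub>m k" and GH: "G * H + L * C = 1\<^sub>m n"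
    and MG: "M * G = G * F" and CM: "C * M = D * C"
    and "schur F" "schur D"
  shows "schur M"
  unfolding schur_def
proof (intro conjI allI impI)
  show "square_mat M" using M by auto
  fix l assume "eigenvalue (cmat M) l"
  moreover have A: "cmat M \<in> carrier_mat n n" using M by simp
  ultimately obtain v where v: "v \<in> carrier_vec n" "v \<noteq> 0\<^sub>v n" "cmat M *\<^sub>v v = l \<cdot>\<^sub>v v"
    using eigenvalue_obtain by blast
  let ?w = "cmat C *\<^sub>v v"
  let ?y = "cmat H *\<^sub>v v"
  have w: "?w \<in> carrier_vec q" using C v by simp
  have y: "?y \<in> carrier_vec k" using H v by simp
  have "cmat D *\<^sub>v ?w = cmat (D * C) *\<^sub>v v"
    using C D v by (simp add: of_real_hom.mat_hom_mult[OF D C])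
  also have "\<dots> = cmat C *\<^sub>v (cmat M *\<^sub>v v)"
    using C M v(1) by (simp add: CM[symmetric] of_real_hom.mat_hom_mult[OF C M])
  also have "\<dots> = l \<cdot>\<^sub>v ?w" using C v by (simp add: mult_mat_vec[of _ q n])
  finally have Dw: "cmat D *\<^sub>v ?w = l \<cdot>\<^sub>v ?w" .
  show "cmod l < 1"
  proof (cases "?w = 0\<^sub>v q")
    case False
    then have "eigenvalue (cmat D) l" using eigenvalueI[OF _ w _ Dw] D by simp
    then show ?thesis using \<open>schur D\<close> by (simp add: schur_def)
  next
    case True
    have "v = cmat (G * H + L * C) *\<^sub>v v"
      using v by (simp add: GH of_real_hom.mat_hom_one)
    also have "cmat (G * H + L * C) = cmat (G * H) + cmat (L * C)"
      using G H L C by (intro eq_matI) (auto simp del: index_mult_mat(1))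
    also have "\<dots> = cmat G * cmat H + cmat L * cmat C"
      unfolding of_real_hom.mat_hom_mult[OF G H] of_real_hom.mat_hom_mult[OF L C] ..
    also have "\<dots> *\<^sub>v v = cmat G *\<^sub>v ?y + cmat L *\<^sub>v ?w"
      using G H L C v by (simp add: add_mult_distrib_mat_vec[of _ n n])
    also have "\<dots> = cmat G *\<^sub>v ?y" using True G L H v by simp
    finally have vy: "v = cmat G *\<^sub>v ?y" .
    then have "?y \<noteq> 0\<^sub>v k" using v(2) mult_mat_zero_vec[of "cmat G" n k] G by force
    have "H * (M * G) = H * G * F" unfolding MG using assoc_mult_mat[OF H G F] by simp
    then have "H * (M * G) = F" using HG F by simp
    have "cmat F *\<^sub>v ?y = cmat (H * (M * G)) *\<^sub>v ?y" using \<open>H * (M * G) = F\<close> by simp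
    also have "\<dots> = cmat H *\<^sub>v (cmat M *\<^sub>v (cmat G *\<^sub>v ?y))"
      unfolding of_real_hom.mat_hom_mult[OF H mult_carrier_mat[OF M G]] of_real_hom.mat_hom_mult[OF M G]
      using M G H y by (simp add: assoc_mult_mat_vec[of _ k n _ k] assoc_mult_mat_vec[of _ n n _ k])
    also have "\<dots> = l \<cdot>\<^sub>v ?y" using v H by (simp add: vy[symmetric] mult_mat_vec[of _ k n])
    finally have "eigenvalue (cmat F) l"
      using eigenvalueI[OF _ y \<open>?y \<noteq> 0\<^sub>v k\<close>] F by simp
    then show ?thesis using \<open>schur F\<close> by (simp add: schur_def)
  qed
qed

section \<open>Positive definite matrices and Lyapunov inequalities\<close>

lemma sym_mat_scalar_prod:
  fixes W :: "real mat"
  assumes W: "W \<in> carrier_mat n n" "W\<^sup>T = W" and "x \<in> carrier_vec n" "y \<in> carrier_vec n"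
  shows "(W *\<^sub>v x) \<bullet> y = x \<bullet> (W *\<^sub>v y)"
  using transpose_vec_mult_scalar[OF W(1) assms(4,3)] W(2) by simp

lemma scalar_prod_self_nonneg:
  fixes x :: "real vec"
  shows "0 \<le> x \<bullet> x"
  using conjugate_square_ge_0_vec[of x] by simp

lemma scalar_prod_self_pos:
  fixes x :: "real vec"
  assumes "x \<in> carrier_vec n" "x \<noteq> 0\<^sub>v n"
  shows "0 < x \<bullet> x"
  using conjugate_square_greater_0_vec[of x n] assms by simp

lemma scalar_prod_Cauchy_real:
  fixes x y :: "real vec"
  assumes "x \<in> carrier_vec n" "y \<in> carrier_vec n"
  shows "(x \<bullet> y)\<^sup>2 \<le> (x \<bullet> x) * (y \<bullet> y)"
proof -
  have "0 \<le> (s \<cdot>\<^sub>v x - t \<cdot>\<^sub>v y) \<bullet> (s \<cdot>\<^sub>v x - t \<cdot>\<^sub>v y)" for s t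
    by (rule scalar_prod_self_nonneg)
  moreover have "(s \<cdot>\<^sub>v x - t \<cdot>\<^sub>v y) \<bullet> (s \<cdot>\<^sub>v x - t \<cdot>\<^sub>v y) =
    s * s * (x \<bullet> x) - 2 * s * t * (x \<bullet> y) + t * t * (y \<bullet> y)" for s t
    using assms comm_scalar_prod[OF assms]
    by (simp add: scalar_prod_minus_distrib[of _ n] minus_scalar_prod_distrib[of _ n] algebra_simps)
  ultimately have *: "0 \<le> s * s * (x \<bullet> x) - 2 * s * t * (x \<bullet> y) + t * t * (y \<bullet> y)" for s t
    by simp
  show ?thesis
  proof (cases "y = 0\<^sub>v n")
    case True
    then show ?thesis using assms by simp
  next
    case False
    then have pos: "0 < y \<bullet> y" using scalar_prod_self_pos assms by blast
    have "0 \<le> (y \<bullet> y) * ((x \<bullet> x) * (y \<bullet> y) - (x \<bullet> y)\<^sup>2)"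
      using *[of "y \<bullet> y" "x \<bullet> y"] by (simp add: algebra_simps power2_eq_square)
    then show ?thesis using pos by (simp add: zero_le_mult_iff)
  qed
qed

text \<open>Each of the \<open>n\<close> rows has squared norm at most n e^2. The bound is crude,
  but it turns a power with small entries into a contraction.\<close>

lemma scalar_prod_mult_mat_abs_le:
  fixes Y :: "real mat"
  assumes Y: "Y \<in> carrier_mat n n" and x: "x \<in> carrier_vec n"
    and e: "\<And>i j. i < n \<Longrightarrow> j < n \<Longrightarrow> \<bar>Y $$ (i, j)\<bar> \<le> e"
  shows "(Y *\<^sub>v x) \<bullet> (Y *\<^sub>v x) \<le> (real n * e)\<^sup>2 * (x \<bullet> x)"
proof -
  have row: "(row Y i \<bullet> x)\<^sup>2 \<le> real n * e\<^sup>2 * (x \<bullet> x)" if i: "i < n" for i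
  proof -
    have "row Y i \<bullet> row Y i = (\<Sum>j = 0..<n. (Y $$ (i, j))\<^sup>2)"
      using Y i by (simp add: scalar_prod_def power2_eq_square)
    also have "\<dots> \<le> (\<Sum>j = 0..<n. e\<^sup>2)"
      using e[OF i] by (intro sum_mono) (auto simp: abs_le_square_iff[symmetric] intro: order_trans[OF _ abs_ge_self])
    finally have "row Y i \<bullet> row Y i \<le> real n * e\<^sup>2" by simp
    then show ?thesis
      using scalar_prod_Cauchy_real[of "row Y i" n x] Y x i scalar_prod_self_nonneg[of x]
      by (smt (verit) mult_right_mono row_carrier_vec)
  qed
  have "(Y *\<^sub>v x) \<bullet> (Y *\<^sub>v x) = (\<Sum>i = 0..<n. (row Y i \<bullet> x)\<^sup>2)"
    using Y by (simp add: scalar_prod_def[of "Y *\<^sub>v x"] power2_eq_square)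
  also have "\<dots> \<le> (\<Sum>i = 0..<n. real n * e\<^sup>2 * (x \<bullet> x))"
    using row by (intro sum_mono) auto
  also have "\<dots> = (real n * e)\<^sup>2 * (x \<bullet> x)" by (simp add: power2_eq_square)
  finally show ?thesis .
qed

text \<open>
  By Cauchy-Schwarz and symmetry the squared norms of the vectors W^k x are log-convex in k. If x violated
  the inequality they would be nondecreasing, contradicting the convergence of W^k to 0.
\<close>
lemma sym_schur_contracts:
  fixes W :: "real mat"
  assumes W: "W \<in> carrier_mat n n" "W\<^sup>T = W" and "schur W"
    and x: "x \<in> carrier_vec n" "x \<noteq> 0\<^sub>v n"
  shows "x \<bullet> (W *\<^sub>v x) < x \<bullet> x"
proof (rule ccontr)
  assume "\<not> ?thesis"
  then have ge: "x \<bullet> x \<le> x \<bullet> (W *\<^sub>v x)" by simp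
  define y where "y k = W ^\<^sub>m k *\<^sub>v x" for k
  define b where "b k = y k \<bullet> y k" for k
  have y: "y k \<in> carrier_vec n" for k
    using mult_mat_vec_carrier[OF pow_carrier_mat[OF W(1)] x(1)] by (simp add: y_def)
  have y0: "y 0 = x" using W x by (simp add: y_def)
  have ySuc: "y (Suc k) = W *\<^sub>v y k" for k
    unfolding y_def pow_mat_Suc_left[OF W(1)] using W x pow_carrier_mat[OF W(1)] by (intro assoc_mult_mat_vec) auto
  have b_pos: "0 < b 0" using x by (simp add: b_def y0 scalar_prod_self_pos)
  have b_nonneg: "0 \<le> b k" for k by (simp add: b_def scalar_prod_self_nonneg)
  have mono: "b k \<le> b (Suc k) \<and> 0 < b k" for k
  proof (induction k)
    case 0
    have "(b 0)\<^sup>2 \<le> (x \<bullet> (W *\<^sub>v x))\<^sup>2"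
      using ge b_nonneg[of 0] by (intro power_mono) (auto simp: b_def y0)
    also have "\<dots> \<le> b 0 * b 1"
      using scalar_prod_Cauchy_real[OF y[of 0] y[of 1]] ySuc[of 0] by (simp add: b_def y0)
    finally show ?case using b_pos by (simp add: power2_eq_square)
  next
    case (Suc k)
    then have pos: "0 < b (Suc k)" by simp
    have "b (Suc k) = y k \<bullet> y (Suc (Suc k))"
      unfolding b_def ySuc[of "Suc k"] using sym_mat_scalar_prod[OF W y[of k] y[of "Suc k"]] ySuc[of k] by simp
    then have "(b (Suc k))\<^sup>2 \<le> b k * b (Suc (Suc k))"
      using scalar_prod_Cauchy_real[OF y[of k] y[of "Suc (Suc k)"]] by (simp add: b_def)
    also have "\<dots> \<le> b (Suc k) * b (Suc (Suc k))"
      using Suc b_nonneg by (intro mult_right_mono) auto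
    finally show ?case using pos by (simp add: power2_eq_square)
  qed
  then have ge0: "b 0 \<le> b k" for k
    by (induction k) (auto intro: order_trans)
  define e where "e = 1 / (2 * real (n + 1))"
  have e: "0 < e" "0 \<le> real n * e" "real n * e < 1" by (auto simp: e_def field_simps)
  obtain N where N: "\<forall>i<n. \<forall>j<n. \<bar>(W ^\<^sub>m N) $$ (i, j)\<bar> < e"
    using schur_pow_small[OF W(1) \<open>schur W\<close> e(1)] by blast
  have "b N \<le> (real n * e)\<^sup>2 * b 0"
    unfolding b_def y_def[of N] y0 using W x N
    by (intro scalar_prod_mult_mat_abs_le) (auto intro: less_imp_le)
  also have "\<dots> < 1 * b 0"
    using e b_pos by (intro mult_strict_right_mono) (auto simp: power_less_one_iff)
  finally show False using ge0[of N] by simp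
qed

text \<open>For small \<open>t > 0\<close> the matrix
  \<open>1\<^sub>m n - t \<cdot>\<^sub>m W\<close> is symmetric and Schur; the strict contraction
  inequality for it is the claim multiplied by \<open>t\<close>. No diagonalization is
  involved.\<close>

lemma pos_def_mat_quadratic_form:
  assumes W: "W \<in> carrier_mat n n" and pd: "pos_def_mat W"
    and x: "x \<in> carrier_vec n" "x \<noteq> 0\<^sub>v n"
  shows "0 < x \<bullet> (W *\<^sub>v x)"
proof -
  have sym: "W\<^sup>T = W" using pd by (simp add: pos_def_mat_def)
  have A: "cmat W \<in> carrier_mat n n" using W by simp
  have fin: "finite (spectrum (cmat W))" using card_finite_spectrum[OF A] by simp
  define t where "t = 1 / (1 + (\<Sum>\<mu>\<in>spectrum (cmat W). cmod \<mu>))"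
  have sum0: "0 \<le> (\<Sum>\<mu>\<in>spectrum (cmat W). cmod \<mu>)" by (intro sum_nonneg) auto
  then have t: "0 < t" by (auto simp: t_def)
  \<comment> \<open>The step t is so small that 1 - t W has all eigenvalues strictly between 0 and 1.\<close>
  define V where "V = 1\<^sub>m n - t \<cdot>\<^sub>m W"
  have "(t \<cdot>\<^sub>m W)\<^sup>T = t \<cdot>\<^sub>m W\<^sup>T" by (intro eq_matI) auto
  then have V: "V \<in> carrier_mat n n" "V\<^sup>T = V"
    using W sym by (simp_all add: V_def transpose_minus[of _ n n] minus_carrier_mat)
  have "schur V"
    unfolding schur_def
  proof (intro conjI allI impI)
    show "square_mat V" using V by auto
    fix k assume "eigenvalue (cmat V) k"
    then obtain v where v: "v \<in> carrier_vec n" "v \<noteq> 0\<^sub>v n" "cmat V *\<^sub>v v = k \<cdot>\<^sub>v v"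
      using eigenvalue_obtain[of "cmat V" n k] V by auto
    have "cmat W = complex_of_real (1 / t) \<cdot>\<^sub>m (1\<^sub>m n - cmat V)"
      using t W by (intro eq_matI) (auto simp: V_def)
    also have "\<dots> *\<^sub>v v = complex_of_real (1 / t) \<cdot>\<^sub>v ((1\<^sub>m n - cmat V) *\<^sub>v v)"
      using V v(1) by (intro eq_vecI) auto
    also have "(1\<^sub>m n - cmat V) *\<^sub>v v = v - k \<cdot>\<^sub>v v"
      using V v by (simp add: minus_mult_distrib_mat_vec[of _ n n])
    also have "complex_of_real (1 / t) \<cdot>\<^sub>v (v - k \<cdot>\<^sub>v v) = ((1 - k) / t) \<cdot>\<^sub>v v"
      using v(1) t by (intro eq_vecI) (auto simp: field_simps)
    finally have ev: "eigenvalue (cmat W) ((1 - k) / t)" using eigenvalueI[OF A v(1,2)] by simp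
    define \<mu> where "\<mu> = (1 - k) / t"
    have "Im \<mu> = 0" "0 < Re \<mu>" using pd ev by (auto simp: pos_def_mat_def \<mu>_def)
    moreover have "cmod \<mu> \<le> (\<Sum>\<mu>\<in>spectrum (cmat W). cmod \<mu>)"
      using ev fin by (intro member_le_sum) (auto simp: \<mu>_def spectrum_def)
    then have "t * cmod \<mu> < 1" using sum0 by (simp add: t_def field_simps)
    moreover have "k = 1 - t * \<mu>" using t by (simp add: \<mu>_def)
    ultimately show "cmod k < 1"
      using t by (auto simp: cmod_def complex_eq_iff mult_pos_pos)
  qed
  from sym_schur_contracts[OF V this x]
  have "x \<bullet> (V *\<^sub>v x) < x \<bullet> x" .
  moreover have "(t \<cdot>\<^sub>m W) *\<^sub>v x = t \<cdot>\<^sub>v (W *\<^sub>v x)" using W x by (intro eq_vecI) auto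
  then have "V *\<^sub>v x = x - t \<cdot>\<^sub>v (W *\<^sub>v x)"
    using W x unfolding V_def by (subst minus_mult_distrib_mat_vec[of _ n n]) auto
  moreover have "x \<bullet> (x - t \<cdot>\<^sub>v (W *\<^sub>v x)) = x \<bullet> x - t * (x \<bullet> (W *\<^sub>v x))"
    using W x by (subst scalar_prod_minus_distrib[of _ n]) auto
  ultimately have "0 < t * (x \<bullet> (W *\<^sub>v x))" by simp
  then show ?thesis using t by (simp add: zero_less_mult_iff)
qed

lemma complex_eigenvector_parts:
  fixes W :: "real mat"
  assumes W: "W \<in> carrier_mat n n" and "eigenvalue (cmat W) k"
  obtains a b where "a \<in> carrier_vec n" "b \<in> carrier_vec n" "a \<noteq> 0\<^sub>v n \<or> b \<noteq> 0\<^sub>v n"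
    "W *\<^sub>v a = Re k \<cdot>\<^sub>v a - Im k \<cdot>\<^sub>v b" "W *\<^sub>v b = Re k \<cdot>\<^sub>v b + Im k \<cdot>\<^sub>v a"
proof -
  obtain v where v: "v \<in> carrier_vec n" "v \<noteq> 0\<^sub>v n" "cmat W *\<^sub>v v = k \<cdot>\<^sub>v v"
    using eigenvalue_obtain[of "cmat W" n k] assms by auto
  have c: "(\<Sum>j = 0..<n. complex_of_real (W $$ (i, j)) * v $ j) = k * v $ i" if "i < n" for i
    using arg_cong[OF v(3), of "\<lambda>u. u $ i"] that W v(1) by (simp add: scalar_prod_def)
  show ?thesis
  proof (rule that[of "map_vec Re v" "map_vec Im v"])
    show "map_vec Re v \<noteq> 0\<^sub>v n \<or> map_vec Im v \<noteq> 0\<^sub>v n"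
    proof (rule ccontr)
      assume "\<not> ?thesis"
      then have "v $ i = 0" if "i < n" for i
        using that v(1) by (auto simp: complex_eq_iff vec_eq_iff)
      with v show False by auto
    qed
    show "W *\<^sub>v map_vec Re v = Re k \<cdot>\<^sub>v map_vec Re v - Im k \<cdot>\<^sub>v map_vec Im v"
    proof (intro eq_vecI)
      fix i assume "i < dim_vec (Re k \<cdot>\<^sub>v map_vec Re v - Im k \<cdot>\<^sub>v map_vec Im v)"
      then have i: "i < n" using v(1) by simp
      show "(W *\<^sub>v map_vec Re v) $ i = (Re k \<cdot>\<^sub>v map_vec Re v - Im k \<cdot>\<^sub>v map_vec Im v) $ i"
        using arg_cong[OF c[OF i], of Re] W v(1) i by (simp add: scalar_prod_def)
    qed (use W v in simp)
    show "W *\<^sub>v map_vec Im v = Re k \<cdot>\<^sub>v map_vec Im v + Im k \<cdot>\<^sub>v map_vec Re v"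
    proof (intro eq_vecI)
      fix i assume "i < dim_vec (Re k \<cdot>\<^sub>v map_vec Im v + Im k \<cdot>\<^sub>v map_vec Re v)"
      then have i: "i < n" using v(1) by simp
      show "(W *\<^sub>v map_vec Im v) $ i = (Re k \<cdot>\<^sub>v map_vec Im v + Im k \<cdot>\<^sub>v map_vec Re v) $ i"
        using arg_cong[OF c[OF i], of Im] W v(1) i by (simp add: scalar_prod_def)
    qed (use W v in simp)
  qed (use v in auto)
qed

text \<open>For an eigenvector a + i b, symmetry yields
  \<open>Im k * (a \<bullet> a + b \<bullet> b) = 0\<close>. Once \<open>k\<close> is real, a
  nonzero one of \<open>a\<close> and \<open>b\<close> is a real eigenvector, at which the form has
  the sign of \<open>k\<close>.\<close>

lemma pos_def_matI:
  assumes W: "W \<in> carrier_mat n n" "W\<^sup>T = W"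
    and pos: "\<And>x. x \<in> carrier_vec n \<Longrightarrow> x \<noteq> 0\<^sub>v n \<Longrightarrow> 0 < x \<bullet> (W *\<^sub>v x)"
  shows "pos_def_mat W"
  unfolding pos_def_mat_def
proof (intro conjI allI impI)
  show "square_mat W" using W by auto
  show "W\<^sup>T = W" by fact
  fix k assume "eigenvalue (cmat W) k"
  from complex_eigenvector_parts[OF W(1) this] obtain a b where
    ab: "a \<in> carrier_vec n" "b \<in> carrier_vec n" "a \<noteq> 0\<^sub>v n \<or> b \<noteq> 0\<^sub>v n"
    "W *\<^sub>v a = Re k \<cdot>\<^sub>v a - Im k \<cdot>\<^sub>v b" "W *\<^sub>v b = Re k \<cdot>\<^sub>v b + Im k \<cdot>\<^sub>v a" .
  have "a \<bullet> (W *\<^sub>v b) = b \<bullet> (W *\<^sub>v a)"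
    using sym_mat_scalar_prod[OF W ab(1,2)] comm_scalar_prod[of "W *\<^sub>v a" n b] W ab(1,2) by simp
  then have "Re k * (a \<bullet> b) + Im k * (a \<bullet> a) = Re k * (b \<bullet> a) - Im k * (b \<bullet> b)"
    using ab by (simp add: scalar_prod_add_distrib[of _ n] scalar_prod_minus_distrib[of _ n])
  then have "Im k * (a \<bullet> a + b \<bullet> b) = 0"
    using comm_scalar_prod[OF ab(1,2)] by (simp add: algebra_simps)
  moreover have "0 < a \<bullet> a + b \<bullet> b"
    using ab(3) scalar_prod_self_pos[OF ab(1)] scalar_prod_self_pos[OF ab(2)]
      scalar_prod_self_nonneg[of a] scalar_prod_self_nonneg[of b] by linarith
  ultimately show Im: "Im k = 0" by simp
  have ab': "W *\<^sub>v a = Re k \<cdot>\<^sub>v a" "W *\<^sub>v b = Re k \<cdot>\<^sub>v b" using ab Im by (auto intro!: eq_vecI)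
  from ab(3) show "0 < Re k"
  proof
    assume "a \<noteq> 0\<^sub>v n"
    from pos[OF ab(1) this] scalar_prod_self_pos[OF ab(1) this] show ?thesis
      using ab(1) by (simp add: ab' zero_less_mult_iff)
  next
    assume "b \<noteq> 0\<^sub>v n"
    from pos[OF ab(2) this] scalar_prod_self_pos[OF ab(2) this] show ?thesis
      using ab(2) by (simp add: ab' zero_less_mult_iff)
  qed
qed

text \<open>For an eigenvector a + i b the form summed over \<open>F *\<^sub>v a\<close> and
  \<open>F *\<^sub>v b\<close> is the square of \<open>cmod k\<close> times its sum over
  \<open>a\<close> and \<open>b\<close>; the decrease forces that factor below 1.\<close>

lemma schur_if_lyapunov:
  fixes P F :: "real mat"
  assumes P: "P \<in> carrier_mat n n" "P\<^sup>T = P" and F: "F \<in> carrier_mat n n"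
    and pos: "\<And>x. x \<in> carrier_vec n \<Longrightarrow> x \<noteq> 0\<^sub>v n \<Longrightarrow> 0 < x \<bullet> (P *\<^sub>v x)"
    and decr: "\<And>x. x \<in> carrier_vec n \<Longrightarrow> x \<noteq> 0\<^sub>v n \<Longrightarrow>
      (F *\<^sub>v x) \<bullet> (P *\<^sub>v (F *\<^sub>v x)) < x \<bullet> (P *\<^sub>v x)"
  shows "schur F"
  unfolding schur_def
proof (intro conjI allI impI)
  show "square_mat F" using F by auto
  fix k assume "eigenvalue (cmat F) k"
  from complex_eigenvector_parts[OF F this] obtain a b where
    ab: "a \<in> carrier_vec n" "b \<in> carrier_vec n" "a \<noteq> 0\<^sub>v n \<or> b \<noteq> 0\<^sub>v n"
    "F *\<^sub>v a = Re k \<cdot>\<^sub>v a - Im k \<cdot>\<^sub>v b" "F *\<^sub>v b = Re k \<cdot>\<^sub>v b + Im k \<cdot>\<^sub>v a" .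
  define Q where "Q x y = x \<bullet> (P *\<^sub>v y)" for x y
  have sym: "Q b a = Q a b"
    unfolding Q_def
    using sym_mat_scalar_prod[OF P ab(1,2)] comm_scalar_prod[of "P *\<^sub>v a" n b] P ab(1,2) by simp
  \<comment> \<open>One of \<open>a\<close> and \<open>b\<close> may vanish; for it only these weak
    inequalities hold.\<close>
  have le: "Q (F *\<^sub>v x) (F *\<^sub>v x) \<le> Q x x \<and> 0 \<le> Q x x" if "x \<in> carrier_vec n" for x
    using pos[of x] decr[of x] that F P by (cases "x = 0\<^sub>v n") (auto simp: Q_def)
  have lt: "Q (F *\<^sub>v x) (F *\<^sub>v x) < Q x x \<and> 0 < Q x x" if "x \<in> carrier_vec n" "x \<noteq> 0\<^sub>v n" for x
    using pos[of x] decr[of x] that by (simp add: Q_def)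
  have Pc: "P *\<^sub>v a \<in> carrier_vec n" "P *\<^sub>v b \<in> carrier_vec n" using P ab by auto
  \<comment> \<open>The mixed terms cancel in the sum over the real and imaginary parts a and b.\<close>
  have "Q (F *\<^sub>v a) (F *\<^sub>v a) = Re k * Re k * Q a a - 2 * Re k * Im k * Q a b + Im k * Im k * Q b b"
    using ab(1,2) P Pc sym unfolding ab(4) Q_def
    by (simp add: mult_minus_distrib_mat_vec[of _ n n] mult_mat_vec[of _ n n]
        scalar_prod_minus_distrib[of _ n] minus_scalar_prod_distrib[of _ n] algebra_simps)
  moreover have "Q (F *\<^sub>v b) (F *\<^sub>v b) = Re k * Re k * Q b b + 2 * Re k * Im k * Q a b + Im k * Im k * Q a a"
    using ab(1,2) P Pc sym unfolding ab(5) Q_def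
    by (simp add: mult_add_distrib_mat_vec[of _ n n] mult_mat_vec[of _ n n]
        scalar_prod_add_distrib[of _ n] add_scalar_prod_distrib[of _ n] algebra_simps)
  ultimately have "Q (F *\<^sub>v a) (F *\<^sub>v a) + Q (F *\<^sub>v b) (F *\<^sub>v b) = (Re k * Re k + Im k * Im k) * (Q a a + Q b b)"
    by (simp add: algebra_simps)
  moreover have "Q (F *\<^sub>v a) (F *\<^sub>v a) + Q (F *\<^sub>v b) (F *\<^sub>v b) < Q a a + Q b b \<and> 0 < Q a a + Q b b"
    using ab(3) le[OF ab(1)] le[OF ab(2)] lt[OF ab(1)] lt[OF ab(2)] by linarith
  ultimately have "(Re k * Re k + Im k * Im k) * (Q a a + Q b b) < 1 * (Q a a + Q b b)" "0 < Q a a + Q b b"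
    by auto
  then have "Re k * Re k + Im k * Im k < 1" by (simp only: mult_less_cancel_right)
  then show "cmod k < 1" by (simp add: cmod_def power2_eq_square)
qed

text \<open>\<open>P\<close> is a truncated Lyapunov series, the sum of F^j (F^T)^j for j <= N. The
  decrease telescopes to the first and the last term, so no limit is taken: it is enough that one
  power of \<open>F\<^sup>T\<close> contracts. The transpose matches the inequality F P F^T < P
  hidden in the block matrix.\<close>

lemma schur_imp_lyapunov:
  fixes F :: "real mat"
  assumes F: "F \<in> carrier_mat n n" and "schur F"
  obtains P where "P \<in> carrier_mat n n" "P\<^sup>T = P"
    "\<And>x. x \<in> carrier_vec n \<Longrightarrow> x \<noteq> 0\<^sub>v n \<Longrightarrow> 0 < x \<bullet> (P *\<^sub>v x)"
    "\<And>x. x \<in> carrier_vec n \<Longrightarrow> x \<noteq> 0\<^sub>v n \<Longrightarrow>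
      (F\<^sup>T *\<^sub>v x) \<bullet> (P *\<^sub>v (F\<^sup>T *\<^sub>v x)) < x \<bullet> (P *\<^sub>v x)"
proof -
  define a where "a j x = (F\<^sup>T ^\<^sub>m j *\<^sub>v x) \<bullet> (F\<^sup>T ^\<^sub>m j *\<^sub>v x)" for j x
  have FT: "F\<^sup>T \<in> carrier_mat n n" using F by simp
  have a0: "a 0 x = x \<bullet> x" if "x \<in> carrier_vec n" for x
    using that F by (simp add: a_def)
  have aSuc: "a j (F\<^sup>T *\<^sub>v x) = a (Suc j) x" if "x \<in> carrier_vec n" for j x
    using assoc_mult_mat_vec[OF pow_carrier_mat[OF FT] FT that] by (simp add: a_def)
  have "\<exists>P \<in> carrier_mat n n. P\<^sup>T = P \<and> (\<forall>x \<in> carrier_vec n. x \<bullet> (P *\<^sub>v x) = (\<Sum>j<k. a j x))" for k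
  proof (induction k)
    case 0
    have "0\<^sub>m n n *\<^sub>v x = 0\<^sub>v n" if "x \<in> carrier_vec n" for x :: "real vec"
      using that by (intro eq_vecI) auto
    then show ?case by (intro bexI[of _ "0\<^sub>m n n"]) auto
  next
    case (Suc k)
    then obtain P where P: "P \<in> carrier_mat n n" "P\<^sup>T = P"
      and q: "\<And>x. x \<in> carrier_vec n \<Longrightarrow> x \<bullet> (P *\<^sub>v x) = (\<Sum>j<k. a j x)" by blast
    \<comment> \<open>The product shifts the previous sum by one power, and
      \<open>1\<^sub>m n\<close> restores the term for exponent 0.\<close>
    define P' where "P' = 1\<^sub>m n + F * (P * F\<^sup>T)"
    have PF: "P * F\<^sup>T \<in> carrier_mat n n" using P F by simp
    have "(F * (P * F\<^sup>T))\<^sup>T = F * (P * F\<^sup>T)"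
      unfolding transpose_mult[OF F PF] transpose_mult[OF P(1) FT] using P F by simp
    then have "P'\<^sup>T = P'"
      using P F by (simp add: P'_def transpose_add[of _ n n])
    moreover have "x \<bullet> (P' *\<^sub>v x) = (\<Sum>j<Suc k. a j x)" if x: "x \<in> carrier_vec n" for x
    proof -
      have FTx: "F\<^sup>T *\<^sub>v x \<in> carrier_vec n" using F x by simp
      have "P' *\<^sub>v x = x + F *\<^sub>v (P *\<^sub>v (F\<^sup>T *\<^sub>v x))"
        using P F x PF FTx by (simp add: P'_def add_mult_distrib_mat_vec[of _ n n] assoc_mult_mat_vec[of _ n n _ n])
      then have "x \<bullet> (P' *\<^sub>v x) = x \<bullet> x + x \<bullet> (F *\<^sub>v (P *\<^sub>v (F\<^sup>T *\<^sub>v x)))"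
        using P F x FTx by (simp add: scalar_prod_add_distrib[of _ n])
      also have "x \<bullet> (F *\<^sub>v (P *\<^sub>v (F\<^sup>T *\<^sub>v x))) = (F\<^sup>T *\<^sub>v x) \<bullet> (P *\<^sub>v (F\<^sup>T *\<^sub>v x))"
        using transpose_vec_mult_scalar[OF F _ x] P FTx by simp
      also have "\<dots> = (\<Sum>j<k. a (Suc j) x)" using q[OF FTx] x by (simp add: aSuc)
      finally show ?thesis by (simp only: sum.lessThan_Suc_shift a0[OF x])
    qed
    moreover have "P' \<in> carrier_mat n n" using PF F by (simp add: P'_def)
    ultimately show ?case by blast
  qed
  note lyap = this
  define e where "e = 1 / (2 * real (n + 1))"
  have e: "0 < e" "0 \<le> real n * e" "real n * e < 1" by (auto simp: e_def field_simps)
  have "schur F\<^sup>T" using schur_transpose[OF F] \<open>schur F\<close> by simp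
  from schur_pow_small[OF FT this e(1)] obtain N where
    N: "\<And>k. N \<le> k \<Longrightarrow> \<forall>i<n. \<forall>j<n. \<bar>(F\<^sup>T ^\<^sub>m k) $$ (i, j)\<bar> < e" by blast
  have aN: "a (Suc N) x < a 0 x" if x: "x \<in> carrier_vec n" "x \<noteq> 0\<^sub>v n" for x :: "real vec"
  proof -
    have "a (Suc N) x \<le> (real n * e)\<^sup>2 * (x \<bullet> x)"
      unfolding a_def using x(1) N[of "Suc N"]
      by (intro scalar_prod_mult_mat_abs_le pow_carrier_mat[OF FT]) (auto intro: less_imp_le)
    also have "\<dots> < 1 * (x \<bullet> x)"
      using e scalar_prod_self_pos[OF x] by (intro mult_strict_right_mono) (auto simp: power_less_one_iff)
    finally show ?thesis using a0 x by simp
  qed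
  obtain P where P: "P \<in> carrier_mat n n" "P\<^sup>T = P"
    and q: "\<And>x. x \<in> carrier_vec n \<Longrightarrow> x \<bullet> (P *\<^sub>v x) = (\<Sum>j<Suc N. a j x)" using lyap by blast
  have a_nonneg: "0 \<le> a j x" for j x by (simp add: a_def scalar_prod_self_nonneg)
  show ?thesis
  proof (rule that[OF P])
    fix x :: "real vec" assume x: "x \<in> carrier_vec n" "x \<noteq> 0\<^sub>v n"
    have "0 < a 0 x" using scalar_prod_self_pos[OF x] a0 x by simp
    moreover have "0 \<le> (\<Sum>j<N. a (Suc j) x)" using a_nonneg by (intro sum_nonneg) auto
    ultimately show "0 < x \<bullet> (P *\<^sub>v x)"
      by (simp only: q[OF x(1)] sum.lessThan_Suc_shift)
    have "(F\<^sup>T *\<^sub>v x) \<bullet> (P *\<^sub>v (F\<^sup>T *\<^sub>v x)) = (\<Sum>j<Suc N. a (Suc j) x)"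
      using q[of "F\<^sup>T *\<^sub>v x"] F x by (simp add: aSuc)
    also have "\<dots> = (\<Sum>j<N. a (Suc j) x) + a (Suc N) x" by simp
    also have "\<dots> < (\<Sum>j<N. a (Suc j) x) + a 0 x" using aN[OF x] by simp
    also have "\<dots> = x \<bullet> (P *\<^sub>v x)" by (simp only: q[OF x(1)] sum.lessThan_Suc_shift)
    finally show "(F\<^sup>T *\<^sub>v x) \<bullet> (P *\<^sub>v (F\<^sup>T *\<^sub>v x)) < x \<bullet> (P *\<^sub>v x)" .
  qed
qed

section \<open>Orthogonality to the resolvent at real points l >= 1\<close>

lemma schur_no_real_eigenvector:
  assumes M: "M \<in> carrier_mat n n" and "schur M" and v: "v \<in> carrier_vec n"
    and ev: "M *\<^sub>v v = l \<cdot>\<^sub>v v" and "1 \<le> l"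
  shows "v = 0\<^sub>v n"
proof (rule ccontr)
  assume "v \<noteq> 0\<^sub>v n"
  then have "eigenvalue M l" using eigenvalueI[OF M v] ev by simp
  then have "cmod (complex_of_real l) < 1"
    using of_real_hom.eigenvalue_hom[OF M] \<open>schur M\<close> unfolding schur_def by blast
  then show False using \<open>1 \<le> l\<close> by simp
qed

lemma schur_resolvent_exists:
  assumes M: "M \<in> carrier_mat n n" and "schur M" and b: "b \<in> carrier_vec n" and "1 \<le> l"
  obtains v where "v \<in> carrier_vec n" "l \<cdot>\<^sub>v v - M *\<^sub>v v = b"
proof -
  define N where "N = l \<cdot>\<^sub>m 1\<^sub>m n - M"
  have N: "N \<in> carrier_mat n n" using M by (auto simp: N_def)
  have Nv: "N *\<^sub>v v = l \<cdot>\<^sub>v v - M *\<^sub>v v" if v: "v \<in> carrier_vec n" for v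
  proof -
    have "(l \<cdot>\<^sub>m 1\<^sub>m n) *\<^sub>v v = l \<cdot>\<^sub>v v" using v by (intro eq_vecI) auto
    then show ?thesis
      using M v unfolding N_def by (subst minus_mult_distrib_mat_vec[of _ n n]) auto
  qed
  have "v = 0\<^sub>v n" if v: "v \<in> carrier_vec n" "N *\<^sub>v v = 0\<^sub>v n" for v
  proof (rule schur_no_real_eigenvector[OF M \<open>schur M\<close> v(1) _ \<open>1 \<le> l\<close>])
    show "M *\<^sub>v v = l \<cdot>\<^sub>v v"
      using v(2) M v(1) unfolding Nv[OF v(1)] by (auto simp: vec_eq_iff)
  qed
  note inv = mat_inverse_if_inj[OF N this]
  have "N *\<^sub>v (the (mat_inverse N) *\<^sub>v b) = b"
    using assoc_mult_mat_vec[OF N inv(1) b] inv(2) b by simp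
  then show ?thesis using that[of "the (mat_inverse N) *\<^sub>v b"] inv(1) b Nv by auto
qed

text \<open>\<open>v\<close> is the resolvent vector (l - M)^(-1) b, written as the solution of an
  equation to avoid an inverse; for Schur \<open>M\<close> it exists and is unique.\<close>

definition resolvent_orthogonal :: "nat \<Rightarrow> real mat \<Rightarrow> real vec \<Rightarrow> real vec \<Rightarrow> bool" where
  "resolvent_orthogonal n M b d \<longleftrightarrow>
    (\<forall>l v. 1 \<le> l \<longrightarrow> v \<in> carrier_vec n \<longrightarrow> l \<cdot>\<^sub>v v - M *\<^sub>v v = b \<longrightarrow> d \<bullet> v = 0)"

text \<open>Pairing the equation for \<open>v\<close> with \<open>d\<close> gives
  \<open>(M\<^sup>T *\<^sub>v d) \<bullet> v = - (d \<bullet> b)\<close>, a value independent of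
  \<open>l\<close>. Since \<open>v\<close> tends to 0 as \<open>l\<close> grows, both sides are
  0.\<close>

lemma resolvent_orthogonal_step:
  assumes M: "M \<in> carrier_mat n n" and "schur M" and b: "b \<in> carrier_vec n" and d: "d \<in> carrier_vec n"
    and orth: "resolvent_orthogonal n M b d"
  shows "d \<bullet> b = 0" "resolvent_orthogonal n M b (M\<^sup>T *\<^sub>v d)"
proof -
  have val: "(M\<^sup>T *\<^sub>v d) \<bullet> v = - (d \<bullet> b)"
    if "1 \<le> l" "v \<in> carrier_vec n" "l \<cdot>\<^sub>v v - M *\<^sub>v v = b" for l v
  proof -
    have "d \<bullet> v = 0" using orth that unfolding resolvent_orthogonal_def by blast
    moreover have "d \<bullet> b = l * (d \<bullet> v) - d \<bullet> (M *\<^sub>v v)"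
      unfolding that(3)[symmetric] using d M that(2) by (subst scalar_prod_minus_distrib[of _ n]) auto
    ultimately show ?thesis using transpose_vec_mult_scalar[OF M that(2) d] by simp
  qed
  define C where "C = (\<Sum>i = 0..<n. \<Sum>j = 0..<n. \<bar>M $$ (i, j)\<bar>)"
  define \<beta> where "\<beta> = (\<Sum>i = 0..<n. \<bar>b $ i\<bar>)"
  define \<delta> where "\<delta> = (\<Sum>i = 0..<n. \<bar>(M\<^sup>T *\<^sub>v d) $ i\<bar>)"
  have nonneg: "0 \<le> C" "0 \<le> \<beta>" "0 \<le> \<delta>" by (auto simp: C_def \<beta>_def \<delta>_def intro!: sum_nonneg)
  show "d \<bullet> b = 0"
  proof (rule ccontr)
    assume ne: "d \<bullet> b \<noteq> 0"
    \<comment> \<open>The norm estimates below end in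
      \<open>\<bar>d \<bullet> b\<bar> * (l - C) \<le> \<delta> * \<beta>\<close>; with this
      \<open>l\<close> the left side exceeds the right side by
      \<open>\<bar>d \<bullet> b\<bar>\<close>.\<close>
    define l where "l = C + 1 + \<delta> * \<beta> / \<bar>d \<bullet> b\<bar>"
    have l: "1 \<le> l" using nonneg by (auto simp: l_def)
    obtain v where v: "v \<in> carrier_vec n" "l \<cdot>\<^sub>v v - M *\<^sub>v v = b"
      using schur_resolvent_exists[OF M \<open>schur M\<close> b l] .
    define \<nu> where "\<nu> = (\<Sum>i = 0..<n. \<bar>v $ i\<bar>)"
    have v_le: "\<bar>v $ j\<bar> \<le> \<nu>" if "j < n" for j
      unfolding \<nu>_def using that by (intro member_le_sum) auto
    have "l * \<bar>v $ i\<bar> \<le> \<bar>b $ i\<bar> + (\<Sum>j = 0..<n. \<bar>M $$ (i, j)\<bar>) * \<nu>" if i: "i < n" for i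
    proof -
      have "l * v $ i = b $ i + (\<Sum>j = 0..<n. M $$ (i, j) * v $ j)"
        using v(1) M i unfolding v(2)[symmetric] by (simp add: scalar_prod_def)
      then have "l * \<bar>v $ i\<bar> = \<bar>b $ i + (\<Sum>j = 0..<n. M $$ (i, j) * v $ j)\<bar>"
        using l by (metis abs_mult abs_of_nonneg order_trans zero_le_one)
      also have "\<dots> \<le> \<bar>b $ i\<bar> + (\<Sum>j = 0..<n. \<bar>M $$ (i, j) * v $ j\<bar>)"
        by (intro order_trans[OF abs_triangle_ineq] add_left_mono sum_abs)
      also have "\<dots> \<le> \<bar>b $ i\<bar> + (\<Sum>j = 0..<n. \<bar>M $$ (i, j)\<bar> * \<nu>)"
        by (intro add_left_mono sum_mono) (auto simp: abs_mult intro!: mult_left_mono v_le)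
      finally show ?thesis by (simp add: sum_distrib_right)
    qed
    then have "(\<Sum>i = 0..<n. l * \<bar>v $ i\<bar>) \<le> (\<Sum>i = 0..<n. \<bar>b $ i\<bar> + (\<Sum>j = 0..<n. \<bar>M $$ (i, j)\<bar>) * \<nu>)"
      by (intro sum_mono) auto
    then have "l * \<nu> \<le> \<beta> + C * \<nu>"
      by (simp add: \<nu>_def[symmetric] sum_distrib_left[symmetric] sum.distrib \<beta>_def C_def
          sum_distrib_right[symmetric])
    then have "(l - C) * \<nu> \<le> \<beta>" by (simp add: algebra_simps)
    have "\<bar>d \<bullet> b\<bar> = \<bar>(M\<^sup>T *\<^sub>v d) \<bullet> v\<bar>" using val[OF l v] by simp
    also have "\<dots> \<le> (\<Sum>i = 0..<n. \<bar>(M\<^sup>T *\<^sub>v d) $ i * v $ i\<bar>)"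
      using v(1) by (simp add: scalar_prod_def[of _ v] sum_abs)
    also have "\<dots> \<le> (\<Sum>i = 0..<n. \<bar>(M\<^sup>T *\<^sub>v d) $ i\<bar> * \<nu>)"
      by (intro sum_mono) (auto simp: abs_mult intro!: mult_left_mono v_le)
    also have "\<dots> = \<delta> * \<nu>" by (simp add: \<delta>_def sum_distrib_right)
    finally have "\<bar>d \<bullet> b\<bar> * (l - C) \<le> \<delta> * \<nu> * (l - C)"
      using nonneg by (intro mult_right_mono) (auto simp: l_def)
    moreover have "\<delta> * \<nu> * (l - C) \<le> \<delta> * \<beta>"
      using mult_left_mono[OF \<open>(l - C) * \<nu> \<le> \<beta>\<close> nonneg(3)] by (simp add: ac_simps)
    moreover have "\<bar>d \<bullet> b\<bar> * (l - C) = \<bar>d \<bullet> b\<bar> + \<delta> * \<beta>" using ne by (simp add: l_def distrib_left)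
    ultimately show False using ne by simp
  qed
  then show "resolvent_orthogonal n M b (M\<^sup>T *\<^sub>v d)"
    using val unfolding resolvent_orthogonal_def by simp
qed

text \<open>Iterating the step makes \<open>d\<close> orthogonal to every M^j b, the part of the
  reachable subspace generated by \<open>b\<close>.\<close>

lemma resolvent_orthogonal_pow:
  assumes M: "M \<in> carrier_mat n n" and "schur M" and b: "b \<in> carrier_vec n" and d: "d \<in> carrier_vec n"
    and orth: "resolvent_orthogonal n M b d"
  shows "(M\<^sup>T ^\<^sub>m j *\<^sub>v d) \<bullet> b = 0"
proof -
  have MT: "M\<^sup>T \<in> carrier_mat n n" using M by simp
  have dj: "M\<^sup>T ^\<^sub>m j *\<^sub>v d \<in> carrier_vec n" for j
    using mult_mat_vec_carrier[OF pow_carrier_mat[OF MT] d] .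
  have "resolvent_orthogonal n M b (M\<^sup>T ^\<^sub>m j *\<^sub>v d)"
  proof (induction j)
    case 0
    then show ?case using orth d M by simp
  next
    case (Suc j)
    show ?case
      unfolding pow_mat_Suc_left[OF MT] assoc_mult_mat_vec[OF MT pow_carrier_mat[OF MT] d]
      by (rule resolvent_orthogonal_step(2)[OF M \<open>schur M\<close> b dj Suc])
  qed
  then show ?thesis using resolvent_orthogonal_step(1)[OF M \<open>schur M\<close> b dj] by blast
qed

section \<open>Informative data\<close>

lemma append_rows_zero_index:
  assumes "A \<in> carrier_mat r k" "j < k"
  shows "i < r \<Longrightarrow> (A @\<^sub>r 0\<^sub>m q k) $$ (i, j) = A $$ (i, j)"
    "i < q \<Longrightarrow> (A @\<^sub>r 0\<^sub>m q k) $$ (i + r, j) = 0"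
  using assms by (auto simp: append_rows_def)

lemma add_add_minus_mat:
  fixes A :: "'a :: ab_group_add mat"
  assumes "A \<in> carrier_mat n k" "E \<in> carrier_mat n k" "B \<in> carrier_mat n k"
  shows "A + E + (B - E) = A + B"
  using assms by (intro eq_matI) auto

lemma add_minus_cancel_mat:
  fixes A :: "'a :: ab_group_add mat"
  assumes "A \<in> carrier_mat n k" "B \<in> carrier_mat n k"
  shows "A + (B - A) = B"
  using assms by (intro eq_matI) auto

lemma add_right_commute_mat:
  fixes A :: "'a :: ab_semigroup_add mat"
  assumes "A \<in> carrier_mat n k" "E \<in> carrier_mat n k" "B \<in> carrier_mat n k"
  shows "A + E + B = A + B + E"
  using assms by (intro eq_matI) (auto simp: ac_simps)

text \<open>\<open>K\<close> is the common gain granted by informativity. The data are arbitrary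
  matrices here; the trajectory behind them enters through hypotheses of single lemmas, as does a
  stabilizable consistent system from which to perturb.\<close>

locale informative_data =
  fixes n m T :: nat and Um Xm Xp K :: "real mat"
  assumes Um: "Um \<in> carrier_mat m T" and Xm: "Xm \<in> carrier_mat n T" and Xp: "Xp \<in> carrier_mat n T"
    and K: "K \<in> carrier_mat m n"
    and schur_closed_loop: "\<And>A B. (A, B) \<in> consistent_systems n m Um Xm Xp \<Longrightarrow>
      (A, B) \<in> stabilizable_pairs n m \<Longrightarrow> schur (A + B * K)"
begin

lemma consistentD:
  assumes "(A, B) \<in> consistent_systems n m Um Xm Xp"
  shows "A \<in> carrier_mat n n" "B \<in> carrier_mat n m" "Xp = A * Xm + B * Um"
  using assms by (auto simp: consistent_systems_def)

lemma resolvent_orthogonal_if_kernel: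
  assumes cons: "(A, B) \<in> consistent_systems n m Um Xm Xp" and stab: "(A, B) \<in> stabilizable_pairs n m"
    and c: "c \<in> carrier_vec n" "Xm\<^sup>T *\<^sub>v c = 0\<^sub>v T" and g: "g \<in> carrier_vec m"
  shows "resolvent_orthogonal n (A + B * K) (B *\<^sub>v g) c"
  unfolding resolvent_orthogonal_def
proof (intro allI impI, rule ccontr)
  fix l v assume l: "1 \<le> l" and v: "v \<in> carrier_vec n" "l \<cdot>\<^sub>v v - (A + B * K) *\<^sub>v v = B *\<^sub>v g" and ne: "c \<bullet> v \<noteq> 0"
  note AB = consistentD[OF cons]
  have Bg: "B *\<^sub>v g \<in> carrier_vec n" using AB g by simp
  \<comment> \<open>Normalized so that \<open>E *\<^sub>v v = B *\<^sub>v g\<close>; by the equation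
    for \<open>v\<close>, this makes \<open>v\<close> an eigenvector of \<open>A + E + B * K\<close>
    for the eigenvalue \<open>l\<close>.\<close>
  define t where "t = 1 / (c \<bullet> v)"
  define E where "E = outer (t \<cdot>\<^sub>v (B *\<^sub>v g)) c"
  have E: "E \<in> carrier_mat n n" using Bg c by (simp add: E_def)
  have "E * Xm = 0\<^sub>m n T"
    using outer_mult_mat[of "t \<cdot>\<^sub>v (B *\<^sub>v g)" n c n Xm T] Bg c Xm by (simp add: E_def)
  then have "(A + E) * Xm = A * Xm"
    using add_mult_distrib_mat[OF AB(1) E Xm] AB Xm by simp
  then have cons': "(A + E, B) \<in> consistent_systems n m Um Xm Xp"
    using AB E by (simp add: consistent_systems_def)
  \<comment> \<open>\<open>B * L = E\<close>, so the gain \<open>K - L\<close> cancels the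
    perturbation and shows the new pair stabilizable, however large \<open>E\<close> is.\<close>
  define L where "L = outer (t \<cdot>\<^sub>v g) c"
  have L: "L \<in> carrier_mat m n" using g c by (simp add: L_def)
  have BL: "B * L = E"
    unfolding L_def E_def using g c AB by (subst mat_mult_outer[of _ m _ n _ n]) (auto simp: mult_mat_vec)
  have BK: "B * K \<in> carrier_mat n n" using AB K by simp
  have "A + E + B * (K - L) = A + E + (B * K - E)"
    using mult_minus_distrib_mat[OF AB(2) K L] BL by simp
  also have "\<dots> = A + B * K" using AB(1) E BK by (rule add_add_minus_mat)
  finally have "schur (A + E + B * (K - L))" using schur_closed_loop[OF cons stab] by simp
  then have "(A + E, B) \<in> stabilizable_pairs n m"
    using AB E K L minus_carrier_mat[OF L, of K] by (auto simp: stabilizable_pairs_def)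
  then have schur: "schur (A + E + B * K)" using schur_closed_loop[OF cons'] by blast
  have M: "A + B * K \<in> carrier_mat n n" using AB BK by simp
  have "A + E + B * K = (A + B * K) + E" using AB(1) E BK by (rule add_right_commute_mat)
  then have "(A + E + B * K) *\<^sub>v v = (A + B * K) *\<^sub>v v + E *\<^sub>v v"
    using add_mult_distrib_mat_vec[OF M E v(1)] by simp
  also have "E *\<^sub>v v = B *\<^sub>v g"
    unfolding E_def using ne Bg c v(1)
    by (subst outer_mult_vec[of _ n _ n]) (auto simp: t_def smult_smult_assoc)
  also have "(A + B * K) *\<^sub>v v + B *\<^sub>v g = l \<cdot>\<^sub>v v"
    unfolding v(2)[symmetric] using M v(1) by (intro eq_vecI) (auto simp del: index_mult_mat_vec)
  finally have "v = 0\<^sub>v n"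
    using schur_no_real_eigenvector[OF _ schur v(1) _ l] AB E BK by simp
  then show False using ne c by simp
qed

lemma kernel_pow_orthogonal_input:
  assumes cons: "(A, B) \<in> consistent_systems n m Um Xm Xp" and stab: "(A, B) \<in> stabilizable_pairs n m"
    and c: "c \<in> carrier_vec n" "Xm\<^sup>T *\<^sub>v c = 0\<^sub>v T" and g: "g \<in> carrier_vec m"
  shows "((A + B * K)\<^sup>T ^\<^sub>m j *\<^sub>v c) \<bullet> (B *\<^sub>v g) = 0"
  using resolvent_orthogonal_pow[OF _ schur_closed_loop[OF cons stab] _ c(1)
      resolvent_orthogonal_if_kernel[OF cons stab c g]] consistentD[OF cons] K g
  by simp

lemma kernel_orthogonal_input:
  assumes cons: "(A, B) \<in> consistent_systems n m Um Xm Xp" and stab: "(A, B) \<in> stabilizable_pairs n m"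
    and c: "c \<in> carrier_vec n" "Xm\<^sup>T *\<^sub>v c = 0\<^sub>v T" and g: "g \<in> carrier_vec m"
  shows "c \<bullet> (B *\<^sub>v g) = 0"
  using kernel_pow_orthogonal_input[OF assms, of 0] consistentD[OF cons] K c by simp

text \<open>A relation with coefficients \<open>a\<close> and \<open>b\<close> leaves the systems (A
  + w a^T, B + w b^T) consistent. For \<open>w\<close> a small positive multiple of \<open>c\<close>
  they are still stabilized by \<open>K\<close>, so \<open>c\<close> has to be orthogonal to the
  range of the new input matrix as well; but its product with the image of \<open>b\<close> has
  grown by a positive multiple of \<open>b \<bullet> b\<close>.\<close>

lemma data_kernel_input_zero:
  assumes cons: "(A, B) \<in> consistent_systems n m Um Xm Xp" and stab: "(A, B) \<in> stabilizable_pairs n m"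
    and c: "c \<in> carrier_vec n" "Xm\<^sup>T *\<^sub>v c = 0\<^sub>v T" "c \<noteq> 0\<^sub>v n"
    and a: "a \<in> carrier_vec n" and b: "b \<in> carrier_vec m"
    and ker: "Xm\<^sup>T *\<^sub>v a + Um\<^sup>T *\<^sub>v b = 0\<^sub>v T"
  shows "b = 0\<^sub>v m"
proof (rule ccontr)
  assume "b \<noteq> 0\<^sub>v m"
  then have bb: "0 < b \<bullet> b" using scalar_prod_self_pos[OF b] by simp
  have cc: "0 < c \<bullet> c" using scalar_prod_self_pos c by simp
  note AB = consistentD[OF cons]
  have BK: "B * K \<in> carrier_mat n n" using AB K by simp
  have M: "A + B * K \<in> carrier_mat n n" using AB BK by simp
  have KTb: "K\<^sup>T *\<^sub>v b \<in> carrier_vec n" using K b by simp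
  have "outer c (a + K\<^sup>T *\<^sub>v b) \<in> carrier_mat n n" using c a KTb by simp
  \<comment> \<open>This direction is the change which the perturbed pair causes in
    \<open>A + B * K\<close>.\<close>
  from schur_open[OF M this schur_closed_loop[OF cons stab]] obtain e
    where e: "0 < e" "schur (A + B * K + e \<cdot>\<^sub>m outer c (a + K\<^sup>T *\<^sub>v b))" by blast
  define w where "w = e \<cdot>\<^sub>v c"
  have w: "w \<in> carrier_vec n" using c by (simp add: w_def)
  define A' where "A' = A + outer w a"
  define B' where "B' = B + outer w b"
  have A': "A' \<in> carrier_mat n n" and B': "B' \<in> carrier_mat n m"
    using AB a b w by (auto simp: A'_def B'_def)
  have oa: "outer w a * Xm = outer w (Xm\<^sup>T *\<^sub>v a)" and ob: "outer w b * Um = outer w (Um\<^sup>T *\<^sub>v b)"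
    using outer_mult_mat[OF w a Xm] outer_mult_mat[OF w b Um] by auto
  have "outer w (Xm\<^sup>T *\<^sub>v a) + outer w (Um\<^sup>T *\<^sub>v b) = 0\<^sub>m n T"
    using outer_add_right[OF w, of "Xm\<^sup>T *\<^sub>v a" T "Um\<^sup>T *\<^sub>v b"] Xm Um a b w by (simp add: ker)
  moreover have "A' * Xm + B' * Um = A * Xm + B * Um + (outer w (Xm\<^sup>T *\<^sub>v a) + outer w (Um\<^sup>T *\<^sub>v b))"
  proof -
    have "A' * Xm = A * Xm + outer w (Xm\<^sup>T *\<^sub>v a)" "B' * Um = B * Um + outer w (Um\<^sup>T *\<^sub>v b)"
      unfolding A'_def B'_def oa[symmetric] ob[symmetric]
      using add_mult_distrib_mat AB Xm Um w a b by (meson outer_carrier)+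
    moreover have "outer w (Xm\<^sup>T *\<^sub>v a) \<in> carrier_mat n T" "outer w (Um\<^sup>T *\<^sub>v b) \<in> carrier_mat n T"
      "A * Xm \<in> carrier_mat n T" "B * Um \<in> carrier_mat n T"
      using w Xm Um a b AB by auto
    ultimately show ?thesis by (intro eq_matI) (auto simp del: index_mult_mat(1))
  qed
  ultimately have "Xp = A' * Xm + B' * Um" using AB Xm Um Xp by simp
  then have cons': "(A', B') \<in> consistent_systems n m Um Xm Xp"
    using A' B' by (simp add: consistent_systems_def)
  have "B' * K = B * K + outer w (K\<^sup>T *\<^sub>v b)"
    using add_mult_distrib_mat[OF AB(2), of "outer w b" K n] outer_mult_mat[OF w b K] w b K by (simp add: B'_def)
  then have "A' + B' * K = A + outer w a + (B * K + outer w (K\<^sup>T *\<^sub>v b))" by (simp add: A'_def)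
  also have "\<dots> = A + B * K + (outer w a + outer w (K\<^sup>T *\<^sub>v b))"
    using AB BK w a KTb by (intro eq_matI) (auto simp del: index_mult_mat(1) simp: outer_def)
  also have "\<dots> = A + B * K + e \<cdot>\<^sub>m outer c (a + K\<^sup>T *\<^sub>v b)"
    unfolding outer_add_right[OF w a KTb] by (simp add: smult_outer w_def)
  finally have "schur (A' + B' * K)" using e by simp
  then have stab': "(A', B') \<in> stabilizable_pairs n m"
    using A' B' K by (auto simp: stabilizable_pairs_def)
  have "B' *\<^sub>v b = B *\<^sub>v b + (b \<bullet> b) \<cdot>\<^sub>v w"
    using add_mult_distrib_mat_vec[OF AB(2), of "outer w b" b] w b outer_mult_vec[OF w b b]
    by (simp add: B'_def)
  moreover have "c \<bullet> (B' *\<^sub>v b) = 0" by (rule kernel_orthogonal_input[OF cons' stab' c(1,2) b])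
  ultimately have "c \<bullet> (B *\<^sub>v b) + (b \<bullet> b) * (e * (c \<bullet> c)) = 0"
    using c w AB b by (simp add: scalar_prod_add_distrib[of _ n] w_def)
  then have "(b \<bullet> b) * (e * (c \<bullet> c)) = 0"
    using kernel_orthogonal_input[OF cons stab c(1,2) b] by simp
  then show False using bb cc e by simp
qed

text \<open>If \<open>c\<close> detected \<open>x T\<close>, the columns of \<open>Xm\<close> would
  be independent, and then a row of \<open>Um\<close> would be a combination of the rows of
  \<open>Xm\<close>.\<close>

lemma trajectory_stays:
  assumes cons: "(A, B) \<in> consistent_systems n m Um Xm Xp" and stab: "(A, B) \<in> stabilizable_pairs n m"
    and c: "c \<in> carrier_vec n" "Xm\<^sup>T *\<^sub>v c = 0\<^sub>v T" and "0 < m" and "0 < T"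
    and u: "\<And>t. t < T \<Longrightarrow> u t \<in> carrier_vec m"
    and x: "\<And>t. t \<le> T \<Longrightarrow> x t \<in> carrier_vec n"
    and step: "\<And>t. t < T \<Longrightarrow> x (Suc t) = A *\<^sub>v x t + B *\<^sub>v u t"
    and Xm_col: "\<And>t. t < T \<Longrightarrow> col Xm t = x t"
  shows "c \<bullet> x T = 0"
proof (rule ccontr)
  assume ne: "c \<bullet> x T \<noteq> 0"
  then have "c \<noteq> 0\<^sub>v n" using x[of T] by auto
  note AB = consistentD[OF cons]
  have BK: "B * K \<in> carrier_mat n n" using AB K by simp
  define M where "M = A + B * K"
  have M: "M \<in> carrier_mat n n" using AB BK by (simp add: M_def)
  have MT: "M\<^sup>T \<in> carrier_mat n n" using M by simp
  define d where "d j = M\<^sup>T ^\<^sub>m j *\<^sub>v c" for j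
  have d: "d j \<in> carrier_vec n" for j
    unfolding d_def using mult_mat_vec_carrier[OF pow_carrier_mat[OF MT] c(1)] .
  have d0: "d 0 = c" using c M by (simp add: d_def)
  have dSuc: "d (Suc j) = M\<^sup>T *\<^sub>v d j" for j
    unfolding d_def pow_mat_Suc_left[OF MT] assoc_mult_mat_vec[OF MT pow_carrier_mat[OF MT] c(1)] ..
  have dB: "d j \<bullet> (B *\<^sub>v g) = 0" if "g \<in> carrier_vec m" for j g
    using kernel_pow_orthogonal_input[OF cons stab c that] by (simp add: d_def M_def)
  have kernel: "(Xm\<^sup>T *\<^sub>v d j) $ t = d j \<bullet> x t" if "t < T" for j t
    using that Xm Xm_col[OF that] comm_scalar_prod[OF d x[of t]] by simp
  have cx: "c \<bullet> x t = 0" if "t < T" for t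
    using kernel[OF that, of 0] c that by (simp add: d0)
  \<comment> \<open>The recorded input differs from the feedback \<open>K *\<^sub>v x t\<close> by
    some \<open>g\<close>, and \<open>d j\<close> annihilates \<open>B *\<^sub>v g\<close>; seen
    through \<open>d j\<close>, the state moves by \<open>M\<close> alone.\<close>
  have shift: "d j \<bullet> x t = c \<bullet> x (t + j)" if "t + j \<le> T" for j t
    using that
  proof (induction j arbitrary: t)
    case 0
    then show ?case by (simp add: d0)
  next
    case (Suc j)
    have t: "t < T" using Suc.prems by simp
    have xt: "x t \<in> carrier_vec n" "u t \<in> carrier_vec m" using x u t by auto
    define g where "g = u t - K *\<^sub>v x t"
    have g: "g \<in> carrier_vec m" using xt K by (simp add: g_def)
    have "M *\<^sub>v x t = A *\<^sub>v x t + B *\<^sub>v (K *\<^sub>v x t)"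
      using AB K BK xt by (simp add: M_def add_mult_distrib_mat_vec[of _ n n] assoc_mult_mat_vec[of _ n m _ n])
    moreover have "B *\<^sub>v g = B *\<^sub>v u t - B *\<^sub>v (K *\<^sub>v x t)"
      unfolding g_def using AB K xt by (intro mult_minus_distrib_mat_vec[of _ n m]) auto
    ultimately have "x (Suc t) = M *\<^sub>v x t + B *\<^sub>v g"
      using AB K xt by (intro eq_vecI) (auto simp: step[OF t] simp del: index_mult_mat_vec)
    then have "d j \<bullet> x (Suc t) = d j \<bullet> (M *\<^sub>v x t)"
      using dB[OF g, of j] d[of j] M xt AB g by (simp add: scalar_prod_add_distrib[of _ n])
    also have "\<dots> = d (Suc j) \<bullet> x t"
      unfolding dSuc using transpose_vec_mult_scalar[OF M xt(1) d] by simp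
    finally show ?case using Suc.IH[of "Suc t"] Suc.prems by simp
  qed
  have "\<alpha> = 0\<^sub>v T" if \<alpha>: "\<alpha> \<in> carrier_vec T" "Xm *\<^sub>v \<alpha> = 0\<^sub>v n" for \<alpha>
  proof (rule ccontr)
    assume "\<alpha> \<noteq> 0\<^sub>v T"
    then have ex: "\<exists>t<T. \<alpha> $ t \<noteq> 0" using \<alpha> by (auto simp: vec_eq_iff)
    define s where "s = Max {t. t < T \<and> \<alpha> $ t \<noteq> 0}"
    have "s \<in> {t. t < T \<and> \<alpha> $ t \<noteq> 0}" unfolding s_def using ex by (intro Max_in) auto
    then have s: "s < T" "\<alpha> $ s \<noteq> 0" by auto
    have above: "\<alpha> $ t = 0" if "s < t" "t < T" for t
    proof (rule ccontr)
      assume "\<alpha> $ t \<noteq> 0"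
      then have "t \<le> s" unfolding s_def using that by (intro Max_ge) auto
      then show False using that by simp
    qed
    \<comment> \<open>This power carries \<open>x s\<close> to \<open>x T\<close> and every earlier
      state to a state before time \<open>T\<close>, which \<open>c\<close> annihilates; only the
      coefficient at \<open>s\<close> survives.\<close>
    let ?j = "T - s"
    have "0 = d ?j \<bullet> (Xm *\<^sub>v \<alpha>)" using \<alpha>(2) d[of ?j] by simp
    also have "\<dots> = (Xm\<^sup>T *\<^sub>v d ?j) \<bullet> \<alpha>" using transpose_vec_mult_scalar[OF Xm \<alpha>(1) d] by simp
    also have "\<dots> = (\<Sum>t = 0..<T. (d ?j \<bullet> x t) * \<alpha> $ t)"
      unfolding scalar_prod_def[of "Xm\<^sup>T *\<^sub>v d ?j"] using \<alpha>(1) kernel by simp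
    also have "\<dots> = (\<Sum>t = 0..<T. if t = s then (c \<bullet> x T) * \<alpha> $ s else 0)"
    proof (intro sum.cong refl)
      fix t assume "t \<in> {0..<T}"
      then consider "t < s" | "t = s" | "s < t" "t < T" by force
      then show "(d ?j \<bullet> x t) * \<alpha> $ t = (if t = s then (c \<bullet> x T) * \<alpha> $ s else 0)"
        by cases (use s shift[of t ?j] cx[of "t + ?j"] above in auto)
    qed
    also have "\<dots> = (c \<bullet> x T) * \<alpha> $ s" using s by simp
    finally show False using ne s by simp
  qed
  then obtain G where G: "G \<in> carrier_mat T n" "G * Xm = 1\<^sub>m T"
    using left_inverse_if_inj[OF Xm] by metis
  \<comment> \<open>A nonzero input vector, available because \<open>0 < m\<close>. The left inverse
    of \<open>Xm\<close> puts \<open>Um\<^sup>T *\<^sub>v b\<close> into the range of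
    \<open>Xm\<^sup>T\<close>, which is a relation with nonzero coefficient
    \<open>b\<close>.\<close>
  define b :: "real vec" where "b = unit_vec m 0"
  have b: "b \<in> carrier_vec m" by (simp add: b_def)
  define y where "y = Um\<^sup>T *\<^sub>v b"
  have y: "y \<in> carrier_vec T" using Um b by (simp add: y_def)
  have "Xm\<^sup>T * G\<^sup>T = 1\<^sub>m T" using transpose_mult[OF G(1) Xm] G(2) by simp
  then have "Xm\<^sup>T *\<^sub>v (G\<^sup>T *\<^sub>v y) = y"
    using assoc_mult_mat_vec[of "Xm\<^sup>T" T n "G\<^sup>T" T y] Xm G(1) y by simp
  moreover have "- (G\<^sup>T *\<^sub>v y) = -1 \<cdot>\<^sub>v (G\<^sup>T *\<^sub>v y)" by (intro eq_vecI) auto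
  ultimately have "Xm\<^sup>T *\<^sub>v (- (G\<^sup>T *\<^sub>v y)) = -1 \<cdot>\<^sub>v y"
    using mult_mat_vec[of "Xm\<^sup>T" T n "G\<^sup>T *\<^sub>v y" "-1"] Xm G(1) y by simp
  also have "\<dots> = - y" by (intro eq_vecI) auto
  finally have "Xm\<^sup>T *\<^sub>v (- (G\<^sup>T *\<^sub>v y)) + Um\<^sup>T *\<^sub>v b = 0\<^sub>v T" using y by (simp add: y_def[symmetric])
  moreover have "- (G\<^sup>T *\<^sub>v y) \<in> carrier_vec n" using G(1) y by simp
  ultimately have "b = 0\<^sub>v m"
    using data_kernel_input_zero[OF cons stab c \<open>c \<noteq> 0\<^sub>v n\<close> _ b] by blast
  then show False using \<open>0 < m\<close> by (simp add: b_def)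
qed

end

section \<open>The linear matrix inequality\<close>

lemma lmi_solution_iff:
  fixes X Y \<Theta> P R :: "real mat"
  assumes X: "X \<in> carrier_mat r k" and Y: "Y \<in> carrier_mat r k" and \<Theta>: "\<Theta> \<in> carrier_mat k r"
    and PR: "X * \<Theta> = P" "Y * \<Theta> = R"
  shows "lmi_solution X Y \<Theta> \<longleftrightarrow> P\<^sup>T = P \<and> pos_def_mat (four_block_mat P R R\<^sup>T P)"
proof -
  have "\<Theta>\<^sup>T * X\<^sup>T = P\<^sup>T" "\<Theta>\<^sup>T * Y\<^sup>T = R\<^sup>T"
    using transpose_mult[OF X \<Theta>] transpose_mult[OF Y \<Theta>] PR by auto
  then show ?thesis unfolding lmi_solution_def PR by auto
qed

lemma block_quadratic_form:
  fixes P R :: "real mat"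
  assumes P: "P \<in> carrier_mat r r" and R: "R \<in> carrier_mat r r"
    and y: "y \<in> carrier_vec r" and z: "z \<in> carrier_vec r"
  shows "(y @\<^sub>v z) \<bullet> (four_block_mat P R R\<^sup>T P *\<^sub>v (y @\<^sub>v z)) =
    y \<bullet> (P *\<^sub>v y) + 2 * (y \<bullet> (R *\<^sub>v z)) + z \<bullet> (P *\<^sub>v z)"
proof -
  have RT: "R\<^sup>T \<in> carrier_mat r r" using R by simp
  have c: "P *\<^sub>v y \<in> carrier_vec r" "R *\<^sub>v z \<in> carrier_vec r" "R\<^sup>T *\<^sub>v y \<in> carrier_vec r" "P *\<^sub>v z \<in> carrier_vec r"
    using P R y z by auto
  have "(y @\<^sub>v z) \<bullet> (four_block_mat P R R\<^sup>T P *\<^sub>v (y @\<^sub>v z)) =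
    y \<bullet> (P *\<^sub>v y + R *\<^sub>v z) + z \<bullet> (R\<^sup>T *\<^sub>v y + P *\<^sub>v z)"
    unfolding four_block_mat_mult_vec[OF P R RT P y z]
    using c by (intro scalar_prod_append[OF y z]) auto
  also have "\<dots> = y \<bullet> (P *\<^sub>v y) + y \<bullet> (R *\<^sub>v z) + (z \<bullet> (R\<^sup>T *\<^sub>v y) + z \<bullet> (P *\<^sub>v z))"
    using c y z by (simp add: scalar_prod_add_distrib[of _ r])
  also have "z \<bullet> (R\<^sup>T *\<^sub>v y) = y \<bullet> (R *\<^sub>v z)"
    using transpose_vec_mult_scalar[OF R z y] comm_scalar_prod[OF z c(3)] by simp
  finally show ?thesis by simp
qed

text \<open>Completing the square: with \<open>w = F\<^sup>T *\<^sub>v y\<close> the form at (y, z)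
  is \<open>Q (w + z) (w + z) + (Q y y - Q w w)\<close>. This is the Schur complement argument
  without inverting \<open>P\<close>.\<close>

lemma block_pos_def_if_lyapunov:
  fixes P F :: "real mat"
  assumes P: "P \<in> carrier_mat r r" "P\<^sup>T = P" and F: "F \<in> carrier_mat r r"
    and pos: "\<And>x. x \<in> carrier_vec r \<Longrightarrow> x \<noteq> 0\<^sub>v r \<Longrightarrow> 0 < x \<bullet> (P *\<^sub>v x)"
    and decr: "\<And>x. x \<in> carrier_vec r \<Longrightarrow> x \<noteq> 0\<^sub>v r \<Longrightarrow>
      (F\<^sup>T *\<^sub>v x) \<bullet> (P *\<^sub>v (F\<^sup>T *\<^sub>v x)) < x \<bullet> (P *\<^sub>v x)"
  shows "pos_def_mat (four_block_mat P (F * P) (F * P)\<^sup>T P)"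
proof -
  let ?W = "four_block_mat P (F * P) (F * P)\<^sup>T P"
  have FP: "F * P \<in> carrier_mat r r" "(F * P)\<^sup>T \<in> carrier_mat r r" using F P by auto
  have W: "?W \<in> carrier_mat (r + r) (r + r)"
    by (rule four_block_carrier_mat[OF P(1) P(1)])
  have W_sym: "(four_block_mat P (F * P) (F * P)\<^sup>T P)\<^sup>T = four_block_mat P (F * P) (F * P)\<^sup>T P"
    unfolding transpose_four_block_mat[OF P(1) FP P(1)] P(2) transpose_transpose ..
  have W_pos: "0 < x \<bullet> (?W *\<^sub>v x)" if x: "x \<in> carrier_vec (r + r)" "x \<noteq> 0\<^sub>v (r + r)" for x
  proof -
  define y where "y = vec_first x r"
  define z where "z = vec_last x r"
  have yz: "y \<in> carrier_vec r" "z \<in> carrier_vec r" "x = y @\<^sub>v z"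
    using vec_first_last_append[OF x(1)] by (simp_all add: y_def z_def)
  have "0\<^sub>v r @\<^sub>v 0\<^sub>v r = (0\<^sub>v (r + r) :: real vec)" by (intro eq_vecI) auto
  then have ne: "y \<noteq> 0\<^sub>v r \<or> z \<noteq> 0\<^sub>v r" using x(2) yz(3) by metis
  define w where "w = F\<^sup>T *\<^sub>v y"
  have w: "w \<in> carrier_vec r" using F yz by (simp add: w_def)
  have wz: "w + z \<in> carrier_vec r" using w yz by simp
  define Q where "Q a b = a \<bullet> (P *\<^sub>v b)" for a b
  have "y \<bullet> (F * P *\<^sub>v z) = Q w z"
    using transpose_vec_mult_scalar[OF F _ yz(1), of "P *\<^sub>v z"] F P yz
    by (simp add: Q_def w_def assoc_mult_mat_vec[of _ r r _ r])
  then have "x \<bullet> (four_block_mat P (F * P) (F * P)\<^sup>T P *\<^sub>v x) = Q y y + 2 * Q w z + Q z z"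
    unfolding yz(3) block_quadratic_form[OF P(1) FP(1) yz(1,2)] by (simp add: Q_def)
  also have "Q (w + z) (w + z) = Q w w + 2 * Q w z + Q z z"
  proof -
    have "Q z w = Q w z"
      unfolding Q_def
      using sym_mat_scalar_prod[OF P yz(2) w] comm_scalar_prod[of "P *\<^sub>v z" r w] P yz(2) w by simp
    moreover have "Q (w + z) (w + z) = Q w w + Q w z + (Q z w + Q z z)"
      using P w yz by (simp add: Q_def mult_add_distrib_mat_vec[of _ r r] add_scalar_prod_distrib[of _ r]
          scalar_prod_add_distrib[of _ r])
    ultimately show ?thesis by simp
  qed
  then have "Q y y + 2 * Q w z + Q z z = Q (w + z) (w + z) + (Q y y - Q w w)" by simp
  also have "0 < \<dots>"
  proof (cases "y = 0\<^sub>v r")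
    case True
    then have "w = 0\<^sub>v r" using F by (simp add: w_def)
    then show ?thesis using pos[OF yz(2)] ne yz P True by (simp add: Q_def)
  next
    case False
    have "0 \<le> Q (w + z) (w + z)"
      using pos[OF wz] P by (cases "w + z = 0\<^sub>v r") (auto simp: Q_def)
    moreover have "Q w w < Q y y" using decr[OF yz(1) False] by (simp add: Q_def w_def)
    ultimately show ?thesis by simp
  qed
  finally show ?thesis .
  qed
  from W W_sym this show ?thesis by (rule pos_def_matI)
qed

lemma block_pos_def_imp_pos:
  fixes P R :: "real mat"
  assumes P: "P \<in> carrier_mat r r" and R: "R \<in> carrier_mat r r"
    and pd: "pos_def_mat (four_block_mat P R R\<^sup>T P)" and y: "y \<in> carrier_vec r" "y \<noteq> 0\<^sub>v r"
    and z: "z \<in> carrier_vec r"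
  shows "0 < y \<bullet> (P *\<^sub>v y) + 2 * (y \<bullet> (R *\<^sub>v z)) + z \<bullet> (P *\<^sub>v z)"
proof -
  have W: "four_block_mat P R R\<^sup>T P \<in> carrier_mat (r + r) (r + r)" using P R by simp
  have "y @\<^sub>v z \<noteq> 0\<^sub>v (r + r)"
  proof
    assume 0: "y @\<^sub>v z = 0\<^sub>v (r + r)"
    have "y $ i = 0" if "i < r" for i
      using arg_cong[OF 0, of "\<lambda>v. v $ i"] that y z by simp
    then show False using y by auto
  qed
  from pos_def_mat_quadratic_form[OF W pd _ this] show ?thesis
    using block_quadratic_form[OF P R y(1) z] y z by simp
qed

text \<open>For fixed \<open>y\<close> the block form is smallest at
  \<open>z = - (F\<^sup>T *\<^sub>v y)\<close>, where it equals the Lyapunov decrease for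
  \<open>F\<^sup>T\<close>; \<open>z = 0\<close> gives positivity of \<open>P\<close>.\<close>

lemma block_pos_def_imp_schur:
  fixes P F :: "real mat"
  assumes P: "P \<in> carrier_mat r r" "P\<^sup>T = P" and F: "F \<in> carrier_mat r r"
    and pd: "pos_def_mat (four_block_mat P (F * P) (F * P)\<^sup>T P)"
  shows "schur F"
proof -
  have FP: "F * P \<in> carrier_mat r r" using F P by simp
  have FT: "F\<^sup>T \<in> carrier_mat r r" using F by simp
  have "schur F\<^sup>T"
  proof (rule schur_if_lyapunov[OF P FT])
    fix y :: "real vec" assume y: "y \<in> carrier_vec r" "y \<noteq> 0\<^sub>v r"
    show "0 < y \<bullet> (P *\<^sub>v y)"
      using block_pos_def_imp_pos[OF P(1) FP pd y, of "0\<^sub>v r"] P FP y by simp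
    define w where "w = F\<^sup>T *\<^sub>v y"
    have w: "w \<in> carrier_vec r" using F y by (simp add: w_def)
    have Pw: "P *\<^sub>v w \<in> carrier_vec r" using P w by simp
    have mw: "- w = -1 \<cdot>\<^sub>v w" by (intro eq_vecI) auto
    have "y \<bullet> (F * P *\<^sub>v (- w)) = - (w \<bullet> (P *\<^sub>v w))"
    proof -
      have "F * P *\<^sub>v (- w) = -1 \<cdot>\<^sub>v (F *\<^sub>v (P *\<^sub>v w))"
        unfolding mw mult_mat_vec[OF FP w] assoc_mult_mat_vec[OF F P(1) w] ..
      then show ?thesis
        using transpose_vec_mult_scalar[OF F Pw y(1)] y w F Pw by (simp add: w_def[symmetric])
    qed
    moreover have "(- w) \<bullet> (P *\<^sub>v (- w)) = w \<bullet> (P *\<^sub>v w)"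
      unfolding mw mult_mat_vec[OF P(1) w] using w Pw by simp
    ultimately have "0 < y \<bullet> (P *\<^sub>v y) - w \<bullet> (P *\<^sub>v w)"
      using block_pos_def_imp_pos[OF P(1) FP pd y, of "- w"] w by simp
    then show "(F\<^sup>T *\<^sub>v y) \<bullet> (P *\<^sub>v (F\<^sup>T *\<^sub>v y)) < y \<bullet> (P *\<^sub>v y)" by (simp add: w_def)
  qed
  then show ?thesis using schur_transpose[OF F] by simp
qed

text \<open>\<open>H\<close> and \<open>C\<close> are the upper and lower rows of \<open>S\<close>,
  \<open>G\<close> and \<open>L\<close> the matching columns of its inverse. Blocks of a system in
  the new coordinates thus become plain products such as \<open>H * A * G\<close>.\<close>

lemma invertible_split:
  fixes S :: "'a :: field mat"
  assumes S: "S \<in> carrier_mat n n" "invertible_mat S" and r: "r \<le> n"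
  obtains H C G L where "H \<in> carrier_mat r n" "C \<in> carrier_mat (n - r) n"
    "G \<in> carrier_mat n r" "L \<in> carrier_mat n (n - r)"
    "H * G = 1\<^sub>m r" "C * L = 1\<^sub>m (n - r)" "C * G = 0\<^sub>m (n - r) r" "G * H + L * C = 1\<^sub>m n"
    "\<And>X k i j. X \<in> carrier_mat n k \<Longrightarrow> i < r \<Longrightarrow> j < k \<Longrightarrow> (H * X) $$ (i, j) = (S * X) $$ (i, j)"
    "\<And>X k i j. X \<in> carrier_mat n k \<Longrightarrow> i < n - r \<Longrightarrow> j < k \<Longrightarrow> (C * X) $$ (i, j) = (S * X) $$ (i + r, j)"
    "\<And>K1 K2 m. K1 \<in> carrier_mat m r \<Longrightarrow> K2 \<in> carrier_mat m (n - r) \<Longrightarrow> (K1 @\<^sub>c K2) * S = K1 * H + K2 * C"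
proof -
  obtain Si where "S * Si = 1\<^sub>m n" "Si * S = 1\<^sub>m (dim_row Si)"
    using S unfolding invertible_mat_def inverts_mat_def by auto
  moreover have "dim_row Si = n" "dim_col Si = n"
    using calculation S by (metis carrier_matD index_mult_mat(2,3) index_one_mat(2,3))+
  ultimately have Si: "Si \<in> carrier_mat n n" "S * Si = 1\<^sub>m n" "Si * S = 1\<^sub>m n" by auto
  have SSi: "(\<Sum>k = 0..<n. S $$ (i, k) * Si $$ (k, j)) = (if i = j then 1 else 0)" if "i < n" "j < n" for i j
    using arg_cong[OF Si(2), of "\<lambda>M. M $$ (i, j)"] that S Si(1) by (simp add: scalar_prod_def)
  have SiS: "(\<Sum>k = 0..<n. Si $$ (i, k) * S $$ (k, j)) = (if i = j then 1 else 0)" if "i < n" "j < n" for i j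
    using arg_cong[OF Si(3), of "\<lambda>M. M $$ (i, j)"] that S Si(1) by (simp add: scalar_prod_def)
  have split: "(\<Sum>k = 0..<n. f k) = (\<Sum>k = 0..<r. f k) + (\<Sum>k = 0..<n - r. f (k + r))" for f :: "nat \<Rightarrow> 'a"
    using sum.atLeastLessThan_concat[of 0 r n f] sum.shift_bounds_nat_ivl[of f 0 r "n - r"] r by simp
  define H where "H = mat r n (\<lambda>(i, j). S $$ (i, j))"
  define C where "C = mat (n - r) n (\<lambda>(i, j). S $$ (i + r, j))"
  define G where "G = mat n r (\<lambda>(i, j). Si $$ (i, j))"
  define L where "L = mat n (n - r) (\<lambda>(i, j). Si $$ (i, j + r))"
  note defs = H_def C_def G_def L_def
  show ?thesis
  proof (rule that[of H C G L])
    show "H * G = 1\<^sub>m r" "C * L = 1\<^sub>m (n - r)" "C * G = 0\<^sub>m (n - r) r"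
      using r by (auto simp: defs scalar_prod_def SSi intro!: eq_matI)
    show "G * H + L * C = 1\<^sub>m n"
    proof (intro eq_matI)
      fix i j assume "i < dim_row (1\<^sub>m n :: 'a mat)" "j < dim_col (1\<^sub>m n :: 'a mat)"
      then show "(G * H + L * C) $$ (i, j) = (1\<^sub>m n :: 'a mat) $$ (i, j)"
        using SiS[of i j] unfolding split by (auto simp: defs scalar_prod_def)
    qed (auto simp: defs)
    show "(H * X) $$ (i, j) = (S * X) $$ (i, j)" if "X \<in> carrier_mat n k" "i < r" "j < k" for X k i j
      using that r S by (auto simp: defs scalar_prod_def)
    show "(C * X) $$ (i, j) = (S * X) $$ (i + r, j)" if "X \<in> carrier_mat n k" "i < n - r" "j < k" for X k i j
      using that r S by (auto simp: defs scalar_prod_def)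
    show "(K1 @\<^sub>c K2) * S = K1 * H + K2 * C"
      if "K1 \<in> carrier_mat m r" "K2 \<in> carrier_mat m (n - r)" for K1 K2 m
    proof (intro eq_matI)
      fix i j assume "i < dim_row (K1 * H + K2 * C)" "j < dim_col (K1 * H + K2 * C)"
      then have ij: "i < m" "j < n" using that by (auto simp: defs)
      have "((K1 @\<^sub>c K2) * S) $$ (i, j) = (\<Sum>k = 0..<n. (K1 @\<^sub>c K2) $$ (i, k) * S $$ (k, j))"
        using that ij S r by (auto simp: append_cols_def scalar_prod_def)
      also have "\<dots> = (K1 * H + K2 * C) $$ (i, j)"
        unfolding split using that ij S r by (auto simp: defs append_cols_def scalar_prod_def)
      finally show "((K1 @\<^sub>c K2) * S) $$ (i, j) = (K1 * H + K2 * C) $$ (i, j)" .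
    qed (use that S in \<open>auto simp: defs append_cols_def\<close>)
  qed (auto simp: defs)
qed

section \<open>The left kernel of the data\<close>

lemma mat_row_zeroI:
  assumes "M \<in> carrier_mat q k" "\<And>i. i < q \<Longrightarrow> row M i = 0\<^sub>v k"
  shows "M = 0\<^sub>m q k"
  using assms by (intro eq_rowI) auto

lemma row_mult_transpose:
  fixes C :: "'a :: comm_semiring_0 mat"
  assumes "C \<in> carrier_mat q n" "X \<in> carrier_mat n k" "i < q"
  shows "row (C * X) i = X\<^sup>T *\<^sub>v row C i"
  using assms by (intro eq_vecI) (auto simp: comm_scalar_prod[of _ n])

context informative_data
begin

text \<open>For a row \<open>c\<close> of \<open>C\<close>,
  \<open>Xp\<^sup>T *\<^sub>v c = 0\<^sub>v T\<close> is a relation between the rows of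
  \<open>Xm\<close> and \<open>Um\<close> with coefficients \<open>A'\<^sup>T *\<^sub>v c\<close>
  and \<open>B'\<^sup>T *\<^sub>v c\<close>, so the latter vanishes. The perturbation behind this is
  made at the stabilizable pair \<open>(A, B)\<close>, while \<open>(A', B')\<close> is any
  consistent pair.\<close>

lemma data_left_kernel:
  assumes cons: "(A, B) \<in> consistent_systems n m Um Xm Xp" and stab: "(A, B) \<in> stabilizable_pairs n m"
    and c0: "c0 \<in> carrier_vec n" "Xm\<^sup>T *\<^sub>v c0 = 0\<^sub>v T" "c0 \<noteq> 0\<^sub>v n"
    and stays: "\<And>c. c \<in> carrier_vec n \<Longrightarrow> Xm\<^sup>T *\<^sub>v c = 0\<^sub>v T \<Longrightarrow> Xp\<^sup>T *\<^sub>v c = 0\<^sub>v T"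
    and cons': "(A', B') \<in> consistent_systems n m Um Xm Xp"
    and C: "C \<in> carrier_mat q n" and CX: "C * Xm = 0\<^sub>m q T"
  shows "C * B' = 0\<^sub>m q m" "C * (A' * Xm) = 0\<^sub>m q T"
proof -
  note AB = consistentD[OF cons']
  have AX: "A' * Xm \<in> carrier_mat n T" using AB Xm by simp
  have BU: "B' * Um \<in> carrier_mat n T" using AB Um by simp
  have rows: "B'\<^sup>T *\<^sub>v row C i = 0\<^sub>v m \<and> (A' * Xm)\<^sup>T *\<^sub>v row C i = 0\<^sub>v T" if i: "i < q" for i
  proof -
    define c where "c = row C i"
    have c: "c \<in> carrier_vec n" using C i by (simp add: c_def)
    have "Xm\<^sup>T *\<^sub>v c = 0\<^sub>v T"
      using row_mult_transpose[OF C Xm i] i unfolding CX c_def by simp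
    from stays[OF c this] have "(A' * Xm + B' * Um)\<^sup>T *\<^sub>v c = 0\<^sub>v T" using AB by simp
    moreover have "(A' * Xm + B' * Um)\<^sup>T = (A' * Xm)\<^sup>T + (B' * Um)\<^sup>T"
      by (rule transpose_add[OF AX BU])
    ultimately have sum0: "(A' * Xm)\<^sup>T *\<^sub>v c + (B' * Um)\<^sup>T *\<^sub>v c = 0\<^sub>v T"
      using AX BU c by (simp add: add_mult_distrib_mat_vec[of _ T n])
    have tr: "(A' * Xm)\<^sup>T *\<^sub>v c = Xm\<^sup>T *\<^sub>v (A'\<^sup>T *\<^sub>v c)" "(B' * Um)\<^sup>T *\<^sub>v c = Um\<^sup>T *\<^sub>v (B'\<^sup>T *\<^sub>v c)"
      unfolding transpose_mult[OF AB(1) Xm] transpose_mult[OF AB(2) Um]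
      using AB Xm Um c by (auto intro!: assoc_mult_mat_vec)
    have "B'\<^sup>T *\<^sub>v c = 0\<^sub>v m"
    proof (rule data_kernel_input_zero[OF cons stab c0])
      show "Xm\<^sup>T *\<^sub>v (A'\<^sup>T *\<^sub>v c) + Um\<^sup>T *\<^sub>v (B'\<^sup>T *\<^sub>v c) = 0\<^sub>v T"
        using sum0 unfolding tr .
    qed (use AB c in auto)
    moreover from this have "(A' * Xm)\<^sup>T *\<^sub>v c = 0\<^sub>v T"
      using sum0 AX c Um unfolding tr(2) by simp
    ultimately show ?thesis by (simp add: c_def)
  qed
  show "C * B' = 0\<^sub>m q m"
    using rows row_mult_transpose[OF C AB(2)] C AB by (intro mat_row_zeroI) auto
  show "C * (A' * Xm) = 0\<^sub>m q T"
    using rows row_mult_transpose[OF C AX] C AX by (intro mat_row_zeroI) auto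
qed

end

text \<open>The injectivity hypotheses say that \<open>X\<close> stacked on \<open>U\<close> has
  full row rank. \<open>Y * P\<close> solves the equation for \<open>X\<close>, and a correction in
  the kernel of \<open>X\<close> then adjusts the value under \<open>U\<close>.\<close>

lemma stacked_right_inverse:
  fixes X U P Q :: "real mat"
  assumes X: "X \<in> carrier_mat r k" and U: "U \<in> carrier_mat m k"
    and P: "P \<in> carrier_mat r l" and Q: "Q \<in> carrier_mat m l"
    and X_inj: "\<And>a. a \<in> carrier_vec r \<Longrightarrow> X\<^sup>T *\<^sub>v a = 0\<^sub>v k \<Longrightarrow> a = 0\<^sub>v r"
    and U_inj: "\<And>a b. a \<in> carrier_vec r \<Longrightarrow> b \<in> carrier_vec m \<Longrightarrow> X\<^sup>T *\<^sub>v a + U\<^sup>T *\<^sub>v b = 0\<^sub>v k \<Longrightarrow> b = 0\<^sub>v m"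
  obtains \<Theta> where "\<Theta> \<in> carrier_mat k l" "X * \<Theta> = P" "U * \<Theta> = Q"
proof -
  obtain Y where Y: "Y \<in> carrier_mat k r" "X * Y = 1\<^sub>m r"
    using right_inverse_if_transpose_inj[OF X X_inj] by metis
  \<comment> \<open>E is a projection onto the kernel of X, on which U is still onto.\<close>
  define E where "E = 1\<^sub>m k - Y * X"
  have YX: "Y * X \<in> carrier_mat k k" using X Y by simp
  have E: "E \<in> carrier_mat k k" using YX by (simp add: E_def minus_carrier_mat)
  have "X * (Y * X) = X" using assoc_mult_mat[OF X Y(1) X] Y X by simp
  then have XE: "X * E = 0\<^sub>m r k"
    using mult_minus_distrib_mat[OF X one_carrier_mat YX] X by (simp add: E_def)
  have UE: "U * E \<in> carrier_mat m k" using U E by simp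
  have UE_inj: "b = 0\<^sub>v m" if b: "b \<in> carrier_vec m" "(U * E)\<^sup>T *\<^sub>v b = 0\<^sub>v k" for b
  proof -
    define y where "y = U\<^sup>T *\<^sub>v b"
    have y: "y \<in> carrier_vec k" using U b by (simp add: y_def)
    have Yy: "Y\<^sup>T *\<^sub>v y \<in> carrier_vec r" using Y y by simp
    have ET: "E\<^sup>T = 1\<^sub>m k - X\<^sup>T * Y\<^sup>T"
      unfolding E_def transpose_minus[OF one_carrier_mat YX] transpose_mult[OF Y(1) X] by simp
    have "E\<^sup>T *\<^sub>v y = y - X\<^sup>T *\<^sub>v (Y\<^sup>T *\<^sub>v y)"
      unfolding ET using X Y y
      by (simp add: minus_mult_distrib_mat_vec[of _ k k] assoc_mult_mat_vec[of _ k r _ k])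
    moreover have "E\<^sup>T *\<^sub>v y = 0\<^sub>v k"
      using b(2) assoc_mult_mat_vec[of "E\<^sup>T" k k "U\<^sup>T" m b] E U b(1)
      unfolding transpose_mult[OF U E] y_def by simp
    moreover have "X\<^sup>T *\<^sub>v (-1 \<cdot>\<^sub>v (Y\<^sup>T *\<^sub>v y)) = -1 \<cdot>\<^sub>v (X\<^sup>T *\<^sub>v (Y\<^sup>T *\<^sub>v y))"
      using X Yy by (intro mult_mat_vec) auto
    moreover have "-1 \<cdot>\<^sub>v (X\<^sup>T *\<^sub>v (Y\<^sup>T *\<^sub>v y)) + y = y - X\<^sup>T *\<^sub>v (Y\<^sup>T *\<^sub>v y)"
      using X Yy y by (intro eq_vecI) (auto simp del: index_mult_mat_vec)
    ultimately have "X\<^sup>T *\<^sub>v (-1 \<cdot>\<^sub>v (Y\<^sup>T *\<^sub>v y)) + U\<^sup>T *\<^sub>v b = 0\<^sub>v k" by (simp add: y_def)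
    then show ?thesis using U_inj[of "-1 \<cdot>\<^sub>v (Y\<^sup>T *\<^sub>v y)" b] Yy b by simp
  qed
  obtain R where R: "R \<in> carrier_mat k m" "U * E * R = 1\<^sub>m m"
    using right_inverse_if_transpose_inj[OF UE UE_inj] by metis
  define N where "N = Q - U * (Y * P)"
  have UYP: "U * (Y * P) \<in> carrier_mat m l" using U Y P by simp
  have N: "N \<in> carrier_mat m l" using UYP by (simp add: N_def minus_carrier_mat)
  define W where "W = E * (R * N)"
  have RN: "R * N \<in> carrier_mat k l" using R N by simp
  have W: "W \<in> carrier_mat k l" using E RN by (simp add: W_def)
  have YP: "Y * P \<in> carrier_mat k l" using Y P by simp
  have "X * W = X * E * (R * N)" unfolding W_def by (rule assoc_mult_mat[OF X E RN, symmetric])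
  then have XW: "X * W = 0\<^sub>m r l" unfolding XE left_mult_zero_mat[OF RN] .
  have "U * W = U * E * (R * N)" unfolding W_def by (rule assoc_mult_mat[OF U E RN, symmetric])
  also have "\<dots> = U * E * R * N" by (rule assoc_mult_mat[OF UE R(1) N, symmetric])
  finally have UW: "U * W = N" using R N by simp
  have "X * (Y * P) = P" using assoc_mult_mat[OF X Y(1) P] Y P by simp
  then have XYPW: "X * (Y * P + W) = P" using mult_add_distrib_mat[OF X YP W] XW P by simp
  have "U * (Y * P + W) = U * (Y * P) + N" using mult_add_distrib_mat[OF U YP W] UW by simp
  moreover have "U * (Y * P) + N = Q"
    unfolding N_def by (rule add_minus_cancel_mat[OF UYP Q])
  ultimately show ?thesis using that[of "Y * P + W"] YP W XYPW by simp
qed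

section \<open>Reduction to the upper left block\<close>

lemma stacked_zero_rows_split:
  fixes X :: "real mat"
  assumes C: "C \<in> carrier_mat q n" and H: "H \<in> carrier_mat r n" and Xm: "Xm \<in> carrier_mat n T"
    and Xhm: "Xhm \<in> carrier_mat r T" and SX: "S * Xm = Xhm @\<^sub>r 0\<^sub>m q T"
    and Hi: "\<And>i j. i < r \<Longrightarrow> j < T \<Longrightarrow> (H * Xm) $$ (i, j) = (S * Xm) $$ (i, j)"
    and Ci: "\<And>i j. i < q \<Longrightarrow> j < T \<Longrightarrow> (C * Xm) $$ (i, j) = (S * Xm) $$ (i + r, j)"
  shows "H * Xm = Xhm" "C * Xm = 0\<^sub>m q T"
proof -
  show "H * Xm = Xhm"
    using H Xm Xhm by (intro eq_matI) (simp_all add: Hi SX append_rows_zero_index[OF Xhm] del: index_mult_mat(1))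
  show "C * Xm = 0\<^sub>m q T"
    using C Xm Xhm by (intro eq_matI) (simp_all add: Ci SX append_rows_zero_index[OF Xhm] del: index_mult_mat(1))
qed

lemma identity_append_cols_mult:
  fixes Y :: "'a :: semiring_1 mat"
  assumes Y: "Y \<in> carrier_mat n k" and r: "r \<le> n" and ij: "i < r" "j < k"
  shows "((1\<^sub>m r @\<^sub>c 0\<^sub>m r (n - r)) * Y) $$ (i, j) = Y $$ (i, j)"
proof -
  have "row (1\<^sub>m r @\<^sub>c 0\<^sub>m r (n - r)) i = (unit_vec n i :: 'a vec)"
    using r ij by (intro eq_vecI) (auto simp: append_cols_def)
  then show ?thesis using Y r ij by (simp add: append_cols_def)
qed

context informative_data
begin

text \<open>Since \<open>G = Xm * Y\<close>, the data force \<open>C * (A * G)\<close> to vanish;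
  together with \<open>C * B = 0\<^sub>m q m\<close> this makes every closed loop block triangular.
  The lower block \<open>C * A * L\<close> is the same for all gains, so one stabilizing gain proves
  it Schur.\<close>

lemma reduced_system:
  fixes H C G L Xhm S :: "real mat"
  assumes cons: "(A, B) \<in> consistent_systems n m Um Xm Xp" and stab: "(A, B) \<in> stabilizable_pairs n m"
    and H: "H \<in> carrier_mat r n" and C: "C \<in> carrier_mat q n"
    and G: "G \<in> carrier_mat n r" and L: "L \<in> carrier_mat n q"
    and HG: "H * G = 1\<^sub>m r" and CL: "C * L = 1\<^sub>m q" and CG: "C * G = 0\<^sub>m q r" and GHLC: "G * H + L * C = 1\<^sub>m n"
    and HX: "H * Xm = Xhm" and CX: "C * Xm = 0\<^sub>m q T"
    and Y: "Y \<in> carrier_mat T r" "Xhm * Y = 1\<^sub>m r"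
    and CB: "C * B = 0\<^sub>m q m" and CAX: "C * (A * Xm) = 0\<^sub>m q T"
    and K1: "K1 \<in> carrier_mat m r" and K2: "K2 \<in> carrier_mat m q"
  shows "H * Xp = H * A * G * Xhm + H * B * Um"
    and "schur (A + B * (K1 * H + K2 * C)) \<longleftrightarrow> schur (H * A * G + H * B * K1)"
proof -
  note AB = consistentD[OF cons]
  have Xhm: "Xhm \<in> carrier_mat r T" using H Xm HX by auto
  have GH: "G * H \<in> carrier_mat n n" and LC: "L * C \<in> carrier_mat n n" using G H L C by auto
  have "Xm = (G * H + L * C) * Xm" using Xm GHLC by simp
  also have "\<dots> = G * Xhm + L * 0\<^sub>m q T"
    unfolding add_mult_distrib_mat[OF GH LC Xm] assoc_mult_mat[OF G H Xm] assoc_mult_mat[OF L C Xm] HX CX ..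
  finally have XmG: "Xm = G * Xhm" using G L Xhm by simp
  have "G = Xm * Y"
    unfolding XmG assoc_mult_mat[OF G Xhm Y(1)] Y(2) using G by simp
  have AXm: "A * Xm \<in> carrier_mat n T" and BUm: "B * Um \<in> carrier_mat n T" using AB Xm Um by auto
  have AG: "A * G \<in> carrier_mat n r" using AB G by simp
  have CAG: "C * (A * G) = 0\<^sub>m q r"
    unfolding \<open>G = Xm * Y\<close> assoc_mult_mat[OF AB(1) Xm Y(1), symmetric] assoc_mult_mat[OF C AXm Y(1), symmetric] CAX
    using Y by simp
  have HA: "H * A \<in> carrier_mat r n" and HB: "H * B \<in> carrier_mat r m" using H AB by auto
  have HAG: "H * A * G \<in> carrier_mat r r" using HA G by simp
  have "H * (A * Xm) = H * A * G * Xhm"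
    unfolding XmG assoc_mult_mat[OF HA G Xhm] using assoc_mult_mat[OF H AB(1), of "G * Xhm" T] G Xhm by simp
  then show "H * Xp = H * A * G * Xhm + H * B * Um"
    unfolding AB(3) mult_add_distrib_mat[OF H AXm BUm] using assoc_mult_mat[OF H AB(2) Um] by simp
  define Kt where "Kt = K1 * H + K2 * C"
  have K1H: "K1 * H \<in> carrier_mat m n" and K2C: "K2 * C \<in> carrier_mat m n" using K1 K2 H C by auto
  have Kt: "Kt \<in> carrier_mat m n" using K1H K2C by (simp add: Kt_def)
  have BKt: "B * Kt \<in> carrier_mat n n" using AB Kt by simp
  define M where "M = A + B * Kt"
  have M: "M \<in> carrier_mat n n" using AB BKt by (simp add: M_def)
  define F where "F = H * A * G + H * B * K1"
  have HBK: "H * B * K1 \<in> carrier_mat r r" using HB K1 by simp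
  have F: "F \<in> carrier_mat r r" using HAG HBK by (simp add: F_def)
  have "Kt * G = K1 * (H * G) + K2 * (C * G)"
    unfolding Kt_def add_mult_distrib_mat[OF K1H K2C G] assoc_mult_mat[OF K1 H G] assoc_mult_mat[OF K2 C G] ..
  then have KtG: "Kt * G = K1" using K1 K2 by (simp add: HG CG)
  have MG': "M * G = A * G + B * K1"
    unfolding M_def add_mult_distrib_mat[OF AB(1) BKt G] assoc_mult_mat[OF AB(2) Kt G] KtG ..
  have BK1: "B * K1 \<in> carrier_mat n r" using AB K1 by simp
  have MGc: "M * G \<in> carrier_mat n r" using M G by simp
  have HMG: "H * (M * G) = F"
    unfolding MG' F_def mult_add_distrib_mat[OF H AG BK1] assoc_mult_mat[OF H AB(1) G] assoc_mult_mat[OF H AB(2) K1] ..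
  have "C * (B * K1) = 0\<^sub>m q r" using assoc_mult_mat[OF C AB(2) K1] CB K1 by simp
  then have CMG: "C * (M * G) = 0\<^sub>m q r"
    unfolding MG' mult_add_distrib_mat[OF C AG BK1] CAG by simp
  have "M * G = (G * H + L * C) * (M * G)" unfolding GHLC left_mult_one_mat[OF MGc] ..
  also have "\<dots> = G * F + L * 0\<^sub>m q r"
    unfolding add_mult_distrib_mat[OF GH LC MGc] assoc_mult_mat[OF G H MGc] assoc_mult_mat[OF L C MGc] HMG CMG ..
  finally have MG: "M * G = G * F" using G F L by simp
  define D where "D = C * A * L"
  have CA: "C * A \<in> carrier_mat q n" using C AB by simp
  have D: "D \<in> carrier_mat q q" using CA L by (simp add: D_def)
  have CAGH: "C * A * (G * H) = 0\<^sub>m q n"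
  proof -
    have "C * A * (G * H) = C * A * G * H" by (rule assoc_mult_mat[OF CA G H, symmetric])
    also have "C * A * G = 0\<^sub>m q r" using assoc_mult_mat[OF C AB(1) G] CAG by simp
    finally show ?thesis using H by simp
  qed
  have DC: "C * A = D * C"
  proof -
    have "C * A = C * A * (G * H + L * C)" unfolding GHLC right_mult_one_mat[OF CA] ..
    also have "\<dots> = 0\<^sub>m q n + C * A * (L * C)"
      unfolding mult_add_distrib_mat[OF CA GH LC] CAGH ..
    also have "\<dots> = D * C" unfolding D_def assoc_mult_mat[OF CA L C] using CA LC by simp
    finally show ?thesis .
  qed
  have intertwine: "C * (A + B * K') = D * C" if K': "K' \<in> carrier_mat m n" for K'
  proof -
    have BK': "B * K' \<in> carrier_mat n n" using AB K' by simp
    have "C * (B * K') = 0\<^sub>m q n" using assoc_mult_mat[OF C AB(2) K'] CB K' by simp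
    then show ?thesis
      unfolding mult_add_distrib_mat[OF C AB(1) BK'] DC using D C by simp
  qed
  obtain K0 where K0: "K0 \<in> carrier_mat m n" "schur (A + B * K0)"
    using stab by (auto simp: stabilizable_pairs_def)
  have M0: "A + B * K0 \<in> carrier_mat n n" using AB K0 by simp
  \<comment> \<open>\<open>D\<close> is a quotient of \<open>A + B * K0\<close>; transposing turns
    it into a restriction, to which \<open>schur_intertwine\<close> applies.\<close>
  have "schur D\<^sup>T"
  proof (rule schur_intertwine[where M = "(A + B * K0)\<^sup>T" and G = "C\<^sup>T" and H = "L\<^sup>T" and n = n and k = q])
    show "L\<^sup>T * C\<^sup>T = 1\<^sub>m q" using transpose_mult[OF C L] CL by simp
    show "(A + B * K0)\<^sup>T * C\<^sup>T = C\<^sup>T * D\<^sup>T"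
      using transpose_mult[OF C M0] transpose_mult[OF D C] intertwine[OF K0(1)] by simp
    show "schur (A + B * K0)\<^sup>T" using schur_transpose[OF M0] K0 by simp
  qed (use M0 D C L in auto)
  then have "schur D" using schur_transpose[OF D] by simp
  have "schur M \<longleftrightarrow> schur F"
    using schur_intertwine[OF M F G H HG MG]
      schur_block_triangular[OF M F D G H C L HG GHLC MG intertwine[OF Kt, folded M_def] _ \<open>schur D\<close>] by blast
  then show "schur (A + B * (K1 * H + K2 * C)) \<longleftrightarrow> schur (H * A * G + H * B * K1)"
    by (simp add: M_def F_def Kt_def)
qed

end

theorem proposition16:
  fixes n m T r :: nat
    and A_true B_true Um Xm Xp S Xhm Xhp :: "real mat"
    and u x :: "nat \<Rightarrow> real vec"
  assumes "0 < n" and "0 < m" and "0 < T"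
    and "\<forall>t < T. u t \<in> carrier_vec m"
    and "\<forall>t \<le> T. x t \<in> carrier_vec n"
    and "\<forall>t < T. x (Suc t) = A_true *\<^sub>v x t + B_true *\<^sub>v u t"
    and "Um = mat_of_cols m (map u [0..<T])"
    and "Xm = mat_of_cols n (map x [0..<T])"
    and "Xp = mat_of_cols n (map x [1..<Suc T])"
    and "(A_true, B_true) \<in> stabilizable_pairs n m"
    and "stab_informative n m Um Xm Xp"
    and "r = vec_space.rank n Xm" and "r < n"
    and "S \<in> carrier_mat n n" and "invertible_mat S"
    and "Xhm \<in> carrier_mat r T" and "vec_space.rank r Xhm = r"
    and "S * Xm = Xhm @\<^sub>r 0\<^sub>m (n - r) T"
    and "Xhp = (1\<^sub>m r @\<^sub>c 0\<^sub>m r (n - r)) * (S * Xp)"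
  shows "(\<exists>\<Theta> \<in> carrier_mat T r. lmi_solution Xhm Xhp \<Theta>) \<and>
    (\<forall>\<Theta> \<in> carrier_mat T r. lmi_solution Xhm Xhp \<Theta> \<longrightarrow>
      (\<forall>K2 \<in> carrier_mat m (n - r).
        let K1 = Um * \<Theta> * the (mat_inverse (Xhm * \<Theta>));
            K = (K1 @\<^sub>c K2) * S
        in \<forall>(A, B) \<in> consistent_systems n m Um Xm Xp \<inter> stabilizable_pairs n m.
             schur (A + B * K)))"
proof -
  have u: "u t \<in> carrier_vec m" if "t < T" for t using assms(4) that by blast
  have x: "x t \<in> carrier_vec n" if "t \<le> T" for t using assms(5) that by blast
  have step: "x (Suc t) = A_true *\<^sub>v x t + B_true *\<^sub>v u t" if "t < T" for t using assms(6) that by blast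
  note stab = assms(10) and S = assms(14,15) and Xhm = assms(16)
  have At: "A_true \<in> carrier_mat n n" and Bt: "B_true \<in> carrier_mat n m"
    using stab by (auto simp: stabilizable_pairs_def)
  have Um: "Um \<in> carrier_mat m T" and Xm: "Xm \<in> carrier_mat n T" and Xp: "Xp \<in> carrier_mat n T"
    using mat_of_cols_carrier[of m "map u [0..<T]"] mat_of_cols_carrier[of n "map x [0..<T]"]
      mat_of_cols_carrier[of n "map x [1..<Suc T]"] unfolding assms(7-9) by auto
  have cols: "col Um t = u t" "col Xm t = x t" "col Xp t = x (Suc t)" if "t < T" for t
    unfolding assms(7-9) using that u x by (subst col_mat_of_cols; simp del: upt_Suc)+
  have "Xp = A_true * Xm + B_true * Um"
  proof (rule mat_col_eqI)
    fix t assume "t < dim_col (A_true * Xm + B_true * Um)"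
    then have t: "t < T" using Um by simp
    show "col Xp t = col (A_true * Xm + B_true * Um) t"
      using col_add[OF mult_carrier_mat[OF At Xm] mult_carrier_mat[OF Bt Um] t]
      unfolding col_mult2[OF At Xm t] col_mult2[OF Bt Um t] cols[OF t] step[OF t] by simp
  qed (use Xp Bt Um in auto)
  then have cons: "(A_true, B_true) \<in> consistent_systems n m Um Xm Xp"
    using At Bt by (simp add: consistent_systems_def)
  obtain K where K: "K \<in> carrier_mat m n"
    and closed_loop: "\<forall>(A, B) \<in> consistent_systems n m Um Xm Xp \<inter> stabilizable_pairs n m. schur (A + B * K)"
    using assms(11) unfolding stab_informative_def by blast
  interpret informative_data n m T Um Xm Xp K
    by unfold_locales (use Um Xm Xp K closed_loop in blast)+
  obtain H C G L where H: "H \<in> carrier_mat r n" and C: "C \<in> carrier_mat (n - r) n"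
    and G: "G \<in> carrier_mat n r" and L: "L \<in> carrier_mat n (n - r)"
    and inv: "H * G = 1\<^sub>m r" "C * L = 1\<^sub>m (n - r)" "C * G = 0\<^sub>m (n - r) r" "G * H + L * C = 1\<^sub>m n"
    and Hi: "\<And>X k i j. X \<in> carrier_mat n k \<Longrightarrow> i < r \<Longrightarrow> j < k \<Longrightarrow> (H * X) $$ (i, j) = (S * X) $$ (i, j)"
    and Ci: "\<And>X k i j. X \<in> carrier_mat n k \<Longrightarrow> i < n - r \<Longrightarrow> j < k \<Longrightarrow> (C * X) $$ (i, j) = (S * X) $$ (i + r, j)"
    and KS: "\<And>K1 K2 m. K1 \<in> carrier_mat m r \<Longrightarrow> K2 \<in> carrier_mat m (n - r) \<Longrightarrow> (K1 @\<^sub>c K2) * S = K1 * H + K2 * C"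
    by (rule invertible_split[OF S less_imp_le[OF assms(13)]], rule that; assumption)
  have HX: "H * Xm = Xhm" and CX: "C * Xm = 0\<^sub>m (n - r) T"
    using stacked_zero_rows_split[OF C H Xm Xhm assms(18)] Hi[OF Xm] Ci[OF Xm] by blast+
  have SXp: "S * Xp \<in> carrier_mat n T" using S Xp by simp
  have J: "(1\<^sub>m r @\<^sub>c 0\<^sub>m r (n - r) :: real mat) \<in> carrier_mat r n"
    using assms(13) by (auto simp: append_cols_def)
  have Xhp: "Xhp = H * Xp"
  proof (rule eq_matI)
    fix i j assume "i < dim_row (H * Xp)" "j < dim_col (H * Xp)"
    then have ij: "i < r" "j < T" using H Xp by auto
    show "Xhp $$ (i, j) = (H * Xp) $$ (i, j)"
      unfolding assms(19) Hi[OF Xp ij]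
      by (rule identity_append_cols_mult[OF SXp less_imp_le[OF assms(13)] ij])
  qed (use assms(19) J H Xp in auto)
  have Xhp_carrier: "Xhp \<in> carrier_mat r T" unfolding Xhp using H Xp by simp

  \<comment> \<open>Here \<open>r < n\<close> enters: \<open>C\<close> has a row, which is a nonzero
    vector of the left kernel of \<open>Xm\<close> and serves as the direction of the
    perturbations.\<close>
  define c0 where "c0 = row C 0"
  have c0: "c0 \<in> carrier_vec n" using row_carrier_vec[OF _ C, of 0] assms(13) by (simp add: c0_def)
  have "Xm\<^sup>T *\<^sub>v c0 = 0\<^sub>v T"
    using row_mult_transpose[OF C Xm, of 0] assms(13) unfolding CX c0_def by simp
  have "c0 \<noteq> 0\<^sub>v n"
  proof
    assume "c0 = 0\<^sub>v n"
    then have "(C * L) $$ (0, 0) = 0" using C L assms(13) col_carrier_vec[OF _ L, of 0] by (simp add: c0_def)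
    then show False using assms(13) by (simp add: inv)
  qed
  \<comment> \<open>The columns of \<open>Xp\<close> other than the last are columns of
    \<open>Xm\<close> too; only \<open>x T\<close> calls for the trajectory argument.\<close>
  have stays: "Xp\<^sup>T *\<^sub>v c = 0\<^sub>v T" if c: "c \<in> carrier_vec n" "Xm\<^sup>T *\<^sub>v c = 0\<^sub>v T" for c
  proof (rule eq_vecI)
    fix t assume "t < dim_vec (0\<^sub>v T :: real vec)"
    then have t: "t < T" by simp
    have "c \<bullet> x (Suc t) = 0"
    proof (cases "Suc t < T")
      case True
      then have "(Xm\<^sup>T *\<^sub>v c) $ Suc t = x (Suc t) \<bullet> c" using Xm cols(2)[of "Suc t"] by simp
      then show ?thesis using c True comm_scalar_prod[OF x c(1), of "Suc t"] by simp
    next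
      case False
      then have "Suc t = T" using t by simp
      then show ?thesis
        using trajectory_stays[OF cons stab c assms(2,3) u x step cols(2)] by simp
    qed
    then show "(Xp\<^sup>T *\<^sub>v c) $ t = 0\<^sub>v T $ t"
      using t Xp cols(3)[OF t] comm_scalar_prod[OF x c(1), of "Suc t"] by simp
  qed (use Xp in auto)
  have left_kernel: "C * B = 0\<^sub>m (n - r) m" "C * (A * Xm) = 0\<^sub>m (n - r) T"
    if "(A, B) \<in> consistent_systems n m Um Xm Xp" for A B
    using data_left_kernel[OF cons stab c0 \<open>Xm\<^sup>T *\<^sub>v c0 = 0\<^sub>v T\<close> \<open>c0 \<noteq> 0\<^sub>v n\<close> _ that C CX] stays by blast+
  have Xhm_inj: "a = 0\<^sub>v r" if "a \<in> carrier_vec r" "Xhm\<^sup>T *\<^sub>v a = 0\<^sub>v T" for a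
    using full_row_rank_transpose_inj[OF Xhm assms(17) that] .
  \<comment> \<open>Applying \<open>H\<^sup>T\<close> to the coefficient \<open>a\<close> lifts a
    relation for \<open>Xhm\<close> to one for \<open>Xm\<close>.\<close>
  have Um_inj: "b = 0\<^sub>v m"
    if ab: "a \<in> carrier_vec r" "b \<in> carrier_vec m" "Xhm\<^sup>T *\<^sub>v a + Um\<^sup>T *\<^sub>v b = 0\<^sub>v T" for a b
  proof (rule data_kernel_input_zero[OF cons stab c0 \<open>Xm\<^sup>T *\<^sub>v c0 = 0\<^sub>v T\<close> \<open>c0 \<noteq> 0\<^sub>v n\<close> _ ab(2)])
    show "H\<^sup>T *\<^sub>v a \<in> carrier_vec n" using H ab by simp
    have "Xhm\<^sup>T *\<^sub>v a = Xm\<^sup>T *\<^sub>v (H\<^sup>T *\<^sub>v a)"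
      using H Xm ab(1) unfolding HX[symmetric] transpose_mult[OF H Xm]
      by (intro assoc_mult_mat_vec) auto
    then show "Xm\<^sup>T *\<^sub>v (H\<^sup>T *\<^sub>v a) + Um\<^sup>T *\<^sub>v b = 0\<^sub>v T" using ab(3) by simp
  qed
  obtain Y where Y: "Y \<in> carrier_mat T r" "Xhm * Y = 1\<^sub>m r"
    using right_inverse_if_transpose_inj[OF Xhm Xhm_inj] by metis
  have Xp_reduced: "Xhp = H * A * G * Xhm + H * B * Um"
    and schur_reduced: "schur (A + B * (K1 * H + K2 * C)) \<longleftrightarrow> schur (H * A * G + H * B * K1)"
    if "(A, B) \<in> consistent_systems n m Um Xm Xp" "(A, B) \<in> stabilizable_pairs n m"
      "K1 \<in> carrier_mat m r" "K2 \<in> carrier_mat m (n - r)" for A B K1 K2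
    unfolding Xhp
    using reduced_system[OF that(1,2) H C G L inv HX CX Y left_kernel[OF that(1)] that(3,4)] by blast+

  have "\<exists>\<Theta> \<in> carrier_mat T r. lmi_solution Xhm Xhp \<Theta>"
  proof -
    \<comment> \<open>The blocks of the informative gain in the coordinates given by
      \<open>S\<close>.\<close>
    define K1 where "K1 = K * G"
    define K2 where "K2 = K * L"
    have K12: "K1 \<in> carrier_mat m r" "K2 \<in> carrier_mat m (n - r)" using K G L by (auto simp: K1_def K2_def)
    have GH: "G * H \<in> carrier_mat n n" and LC: "L * C \<in> carrier_mat n n" using G H L C by auto
    have "K1 * H + K2 * C = K * (G * H + L * C)"
      unfolding K1_def K2_def mult_add_distrib_mat[OF K GH LC] assoc_mult_mat[OF K G H] assoc_mult_mat[OF K L C] ..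
    then have KK: "K1 * H + K2 * C = K" using K by (simp add: inv)
    define F where "F = H * A_true * G + H * B_true * K1"
    have HAG: "H * A_true * G \<in> carrier_mat r r" and HB: "H * B_true \<in> carrier_mat r m" using H At Bt G by auto
    have F: "F \<in> carrier_mat r r" using HAG HB K12 by (simp add: F_def)
    have "schur F"
      using schur_reduced[OF cons stab K12] schur_closed_loop[OF cons stab] by (simp add: KK F_def)
    obtain P where P: "P \<in> carrier_mat r r" "P\<^sup>T = P"
      and pos: "\<And>x. x \<in> carrier_vec r \<Longrightarrow> x \<noteq> 0\<^sub>v r \<Longrightarrow> 0 < x \<bullet> (P *\<^sub>v x)"
      and decr: "\<And>x. x \<in> carrier_vec r \<Longrightarrow> x \<noteq> 0\<^sub>v r \<Longrightarrow>
        (F\<^sup>T *\<^sub>v x) \<bullet> (P *\<^sub>v (F\<^sup>T *\<^sub>v x)) < x \<bullet> (P *\<^sub>v x)"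
      by (rule schur_imp_lyapunov[OF F \<open>schur F\<close>], rule that; assumption)
    have K1P: "K1 * P \<in> carrier_mat m r" using K12 P by simp
    \<comment> \<open>The value \<open>K1 * P\<close> for the inputs makes
      \<open>Xhp * \<Theta>\<close> equal to \<open>F * P\<close>, the off-diagonal block that
      belongs to the Lyapunov matrix \<open>P\<close>.\<close>
    obtain \<Theta> where \<Theta>: "\<Theta> \<in> carrier_mat T r" "Xhm * \<Theta> = P" "Um * \<Theta> = K1 * P"
      by (rule stacked_right_inverse[OF Xhm Um P(1) K1P]; (rule Xhm_inj Um_inj that; assumption))
    have "Xhp * \<Theta> = H * A_true * G * (Xhm * \<Theta>) + H * B_true * (Um * \<Theta>)"
      unfolding Xp_reduced[OF cons stab K12]
      using HAG HB Xhm Um \<Theta>(1) by (subst add_mult_distrib_mat[of _ r T]) (auto intro!: arg_cong2[where f = "(+)"] assoc_mult_mat)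
    also have "\<dots> = F * P"
      unfolding \<Theta> F_def using assoc_mult_mat[OF HB K12(1) P(1)] add_mult_distrib_mat[OF HAG _ P(1)] HB K12 by simp
    finally have "lmi_solution Xhm Xhp \<Theta>"
      using lmi_solution_iff[OF Xhm Xhp_carrier \<Theta>(1,2)] P(2) block_pos_def_if_lyapunov[OF P F pos decr] by simp
    then show ?thesis using \<Theta>(1) by blast
  qed
  moreover have "schur (A + B * ((Um * \<Theta> * the (mat_inverse (Xhm * \<Theta>)) @\<^sub>c K2) * S))"
    if \<Theta>: "\<Theta> \<in> carrier_mat T r" and lmi: "lmi_solution Xhm Xhp \<Theta>" and K2: "K2 \<in> carrier_mat m (n - r)"
      and cons': "(A, B) \<in> consistent_systems n m Um Xm Xp" and stab': "(A, B) \<in> stabilizable_pairs n m"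
    for \<Theta> K2 A B
  proof -
    note AB = consistentD[OF cons']
    define P where "P = Xhm * \<Theta>"
    have P: "P \<in> carrier_mat r r" using Xhm \<Theta> by (simp add: P_def)
    have R: "Xhp * \<Theta> \<in> carrier_mat r r" using Xhp_carrier \<Theta> by simp
    have pd: "P\<^sup>T = P" "pos_def_mat (four_block_mat P (Xhp * \<Theta>) (Xhp * \<Theta>)\<^sup>T P)"
      using lmi lmi_solution_iff[OF Xhm Xhp_carrier \<Theta> P_def[symmetric] refl] by auto
    have P_inj: "v = 0\<^sub>v r" if v: "v \<in> carrier_vec r" "P *\<^sub>v v = 0\<^sub>v r" for v
    proof (rule ccontr)
      assume "v \<noteq> 0\<^sub>v r"
      from block_pos_def_imp_pos[OF P R pd(2) v(1) this, of "0\<^sub>v r"] show False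
        using v P R by simp
    qed
    have Pinv: "the (mat_inverse P) \<in> carrier_mat r r" "the (mat_inverse P) * P = 1\<^sub>m r"
      using mat_inverse_if_inj[OF P] P_inj by blast+
    define K1 where "K1 = Um * \<Theta> * the (mat_inverse P)"
    have Um\<Theta>: "Um * \<Theta> \<in> carrier_mat m r" using Um \<Theta> by simp
    have K1: "K1 \<in> carrier_mat m r" using Um\<Theta> Pinv by (simp add: K1_def)
    have K1P: "K1 * P = Um * \<Theta>"
      unfolding K1_def assoc_mult_mat[OF Um\<Theta> Pinv(1) P] Pinv(2) right_mult_one_mat[OF Um\<Theta>] ..
    define F where "F = H * A * G + H * B * K1"
    have HAG: "H * A * G \<in> carrier_mat r r" and HB: "H * B \<in> carrier_mat r m" using H AB G by auto
    have F: "F \<in> carrier_mat r r" using HAG HB K1 by (simp add: F_def)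
    \<comment> \<open>The left side depends on the data alone: as \<open>P\<close> is invertible,
      \<open>F\<close> is the same matrix for every consistent stabilizable pair.\<close>
    have "Xhp * \<Theta> = H * A * G * (Xhm * \<Theta>) + H * B * (Um * \<Theta>)"
      unfolding Xp_reduced[OF cons' stab' K1 K2]
      using HAG HB Xhm Um \<Theta> by (subst add_mult_distrib_mat[of _ r T]) (auto intro!: arg_cong2[where f = "(+)"] assoc_mult_mat)
    also have "\<dots> = F * P"
      unfolding P_def[symmetric] K1P[symmetric] F_def
      using assoc_mult_mat[OF HB K1 P] add_mult_distrib_mat[OF HAG _ P] HB K1 by simp
    finally have "schur F" using block_pos_def_imp_schur[OF P pd(1) F] pd(2) by simp
    then show ?thesis
      using schur_reduced[OF cons' stab' K1 K2] KS[OF K1 K2] by (simp add: F_def K1_def P_def)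
  qed
  ultimately show ?thesis unfolding Let_def by blast
qed

end
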